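(* Let $\phi_T$ and $\phi_S$ be the two target functions defined in the context, and let $\Phi_T=\{\phi_T\}$ and $\Phi_S=\{\phi_S\}$. Both $\Phi_T$ and $\Phi_S$ are compatible with respect to the convergence problem, but $\Phi=\Phi_T\cup\Phi_S$ is not.
   Context: Robot model. Robots $r_1,\dots,r_n$ are points in the plane $\mathbb{R}^2$, which carries a fixed right-handed global coordinate system $Z_0$. Time is discrete, $t=0,1,2,\dots$; $\mathbf{x}_t(r_i)$ is the position of $r_i$ at time $t$ in $Z_0$, and the configuration at $t$ is the multiset $P_t=\{\mathbf{x}_t(r_i):1\le i\le n\}$. Robot $r_i$ has a local coordinate system $Z_i$, right-handed, with its own unit length and axis directions (arbitrary, fixed over time), whose origin is always the current position of $r_i$; $\gamma_i$ denotes the coordinate transformation from $Z_i$ to $Z_0$ (an orientation-preserving similarity with $\gamma_i((0,0))=\mathbf{x}_t(r_i)$ at time $t$). A target function $\phi$ assigns to every multiset $P$ of $n$ points of $\mathbb{R}^2$ (for every $n\ge1$) an element of $\mathbb{R}^2\cup\{\bot\}$, with $\phi(P)=\bot$ if and only if $(0,0)\notin P$. Each robot $r_i$ is assigned a target function $\phi_i$. The scheduler is semi-synchronous: at each time $t$ an arbitrary subset of robots is activated; if $r_i$ is activated at $t$ then $\mathbf{x}_{t+1}(r_i)=\gamma_i(\phi_i(\gamma_i^{-1}(P_t)))$, otherwise $\mathbf{x}_{t+1}(r_i)=\mathbf{x}_t(r_i)$. The schedule is fair: every robot is activated infinitely often. The resulting sequence $P_0,P_1,\dots$ is an execution. Compatibility.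 A set $\Phi$ of target functions is compatible with respect to a problem if, for every number $n$ of robots, every assignment of target functions from $\Phi$ to the robots (different robots may get different ones), every choice of local coordinate systems, every initial configuration and every fair schedule, the execution satisfies the requirement of the problem. The convergence problem (no faults) requires that all robots converge to one common point as $t\to\infty$. Target functions. For a multiset $Q$ of points, $g(Q)$ is its center of gravity (with multiplicity). Condition $\Psi$ on a multiset $P$: $|P|=7$, $(0,0)\in P$, $P=T\cup S$ where $T$ is the vertex set of an equilateral triangle and $S$ is the vertex set of a square, $T$ and $S$ have the same side length, and the triangle and the square do not overlap each other (the closed regions are disjoint). For $P$ with $(0,0)\in P$: - $\phi_T(P)=g(T)/2$ if $P$ satisfies $\Psi$ and $(0,0)\in T$; $\phi_T(P)=g(P)$ in all other cases. - $\phi_S(P)=g(S)/2$ if $P$ satisfies $\Psi$ and $(0,0)\in S$; $\phi_S(P)=g(P)$ in all other cases. *)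

theory Defs
  imports "HOL-Analysis.Analysis" "HOL-Library.Multiset"
begin

section \<open>Semi-synchronous oblivious robots in the plane\<close>

type_synonym point = "real ^ 2"

text \<open>\<^term>\<open>None\<close> plays the role of the undefined value.\<close>

type_synonym target = "point multiset \<Rightarrow> point option"

definition target_function :: "target \<Rightarrow> bool" where
  "target_function \<phi> \<longleftrightarrow> (\<forall>P. P \<noteq> {#} \<longrightarrow> (\<phi> P = None \<longleftrightarrow> 0 \<notin># P))"

text \<open>A right-handed local coordinate system without its origin: unit length, and the rotation
  taking the global axes to the local ones.\<close>

type_synonym frame = "real \<times> (real ^ 2 ^ 2)"

definition local_frame :: "frame \<Rightarrow> bool" where
  "local_frame Z \<longleftrightarrow> fst Z > 0 \<and> rotation_matrix (snd Z)"

definition to_global :: "frame \<Rightarrow> point \<Rightarrow> point \<Rightarrow> point" where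
  "to_global Z origin y = origin + fst Z *\<^sub>R (snd Z *v y)"

text \<open>Robots are numbered \<open>0, \<dots>, n - 1\<close>; \<open>x t i\<close> is the global position of robot \<open>i\<close> at time \<open>t\<close>.\<close>

definition configuration :: "nat \<Rightarrow> (nat \<Rightarrow> nat \<Rightarrow> point) \<Rightarrow> nat \<Rightarrow> point multiset" where
  "configuration n x t = image_mset (x t) (mset_set {..<n})"

definition fair_schedule :: "nat \<Rightarrow> (nat \<Rightarrow> nat set) \<Rightarrow> bool" where
  "fair_schedule n A \<longleftrightarrow> (\<forall>t. A t \<subseteq> {..<n}) \<and> (\<forall>i<n. infinite {t. i \<in> A t})"

text \<open>In its own coordinates an activated robot always sees a robot at the origin (itself), so a
  target function returns a point there.\<close>

definition execution ::
  "nat \<Rightarrow> (nat \<Rightarrow> target) \<Rightarrow> (nat \<Rightarrow> frame) \<Rightarrow> (nat \<Rightarrow> nat set) \<Rightarrow> (nat \<Rightarrow> nat \<Rightarrow> point) \<Rightarrow> bool"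
  where
  "execution n \<phi> Z A x \<longleftrightarrow>
     (\<forall>t. \<forall>i<n.
        if i \<in> A t then
          (let \<gamma> = to_global (Z i) (x t i)
           in Some (x (Suc t) i) = map_option \<gamma> (\<phi> i (image_mset (inv \<gamma>) (configuration n x t))))
        else x (Suc t) i = x t i)"

type_synonym problem = "nat \<Rightarrow> (nat \<Rightarrow> nat \<Rightarrow> point) \<Rightarrow> bool"

definition compatible :: "target set \<Rightarrow> problem \<Rightarrow> bool" where
  "compatible \<Phi> req \<longleftrightarrow>
     (\<forall>n \<phi> Z A x.
        n \<ge> 1 \<longrightarrow> (\<forall>i<n. \<phi> i \<in> \<Phi>) \<longrightarrow> (\<forall>i<n. local_frame (Z i)) \<longrightarrow>
        fair_schedule n A \<longrightarrow> execution n \<phi> Z A x \<longrightarrow> req n x)"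

definition convergence :: problem where
  "convergence n x \<longleftrightarrow> (\<exists>p. \<forall>i<n. (\<lambda>t. x t i) \<longlonglongrightarrow> p)"

section \<open>The two target functions\<close>

definition center_of_gravity :: "point multiset \<Rightarrow> point" where
  "center_of_gravity Q = sum_mset Q /\<^sub>R real (size Q)"

definition equilateral_triangle :: "point set \<Rightarrow> real \<Rightarrow> bool" where
  "equilateral_triangle T s \<longleftrightarrow>
     s > 0 \<and> (\<exists>a b c. T = {a, b, c} \<and> dist a b = s \<and> dist b c = s \<and> dist c a = s)"

definition square :: "point set \<Rightarrow> real \<Rightarrow> bool" where
  "square S s \<longleftrightarrow>
     s > 0 \<and> (\<exists>a u v. S = {a, a + u, a + u + v, a + v} \<and> norm u = s \<and> norm v = s \<and> u \<bullet> v = 0)"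

definition triangle_square :: "point multiset \<Rightarrow> point set \<Rightarrow> point set \<Rightarrow> bool" where
  "triangle_square P T S \<longleftrightarrow>
     size P = 7 \<and> 0 \<in># P \<and> P = mset_set T + mset_set S \<and>
     (\<exists>s. equilateral_triangle T s \<and> square S s) \<and> convex hull T \<inter> convex hull S = {}"

definition Psi :: "point multiset \<Rightarrow> bool" where
  "Psi P \<longleftrightarrow> (\<exists>T S. triangle_square P T S)"

text \<open>The decomposition is unique (\<open>triangle_square_unique\<close> below), so these are meaningful
  whenever \<^term>\<open>Psi P\<close> holds.\<close>

definition triangle_part :: "point multiset \<Rightarrow> point set" where
  "triangle_part P = (THE T. \<exists>S. triangle_square P T S)"

definition square_part :: "point multiset \<Rightarrow> point set" where
  "square_part P = (THE S. \<exists>T. triangle_square P T S)"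

definition phi_T :: target where
  "phi_T P =
     (if 0 \<notin># P then None
      else if Psi P \<and> 0 \<in> triangle_part P
        then Some (center_of_gravity (mset_set (triangle_part P)) /\<^sub>R 2)
      else Some (center_of_gravity P))"

definition phi_S :: target where
  "phi_S P =
     (if 0 \<notin># P then None
      else if Psi P \<and> 0 \<in> square_part P
        then Some (center_of_gravity (mset_set (square_part P)) /\<^sub>R 2)
      else Some (center_of_gravity P))"

lemma target_function_phi_T: "target_function phi_T"
  by (simp add: target_function_def phi_T_def)

lemma target_function_phi_S: "target_function phi_S"
  by (simp add: target_function_def phi_S_def)

subsection \<open>Uniqueness of the decomposition\<close>

lemma equilateral_triangle_card:
  assumes "equilateral_triangle T s"
  shows "finite T" "card T = 3"
proof -
  from assms obtain a b c where s: "s > 0" and T: "T = {a, b, c}"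
    and d: "dist a b = s" "dist b c = s" "dist c a = s"
    unfolding equilateral_triangle_def by blast
  have "a \<noteq> b" "b \<noteq> c" "c \<noteq> a"
    using s d by auto
  then show "finite T" "card T = 3"
    using T by auto
qed

lemma equilateral_triangle_dist:
  assumes "equilateral_triangle T s" "p \<in> T" "q \<in> T" "p \<noteq> q"
  shows "dist p q = s"
  using assms unfolding equilateral_triangle_def by (auto simp: dist_commute)

lemma square_points:
  assumes "square S s"
  obtains a u v where "s > 0" "S = {a, a + u, a + u + v, a + v}"
    "u \<bullet> u = s\<^sup>2" "v \<bullet> v = s\<^sup>2" "u \<bullet> v = 0" "u \<noteq> 0" "v \<noteq> 0" "u \<noteq> v" "u + v \<noteq> 0"
proof -
  from assms obtain a u v where *: "s > 0" "S = {a, a + u, a + u + v, a + v}"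
    "norm u = s" "norm v = s" "u \<bullet> v = 0"
    unfolding square_def by blast
  then have 1: "u \<bullet> u = s\<^sup>2" "v \<bullet> v = s\<^sup>2"
    by (simp_all add: power2_norm_eq_inner [symmetric])
  have 2: "u \<noteq> 0" "v \<noteq> 0"
    using * by auto
  have "u \<noteq> v"
    using *(5) 2 by auto
  moreover have "u + v \<noteq> 0"
    using *(5) 2 by (metis add_eq_0_iff inner_eq_zero_iff inner_minus_right neg_equal_0_iff_equal)
  ultimately show thesis
    using that * 1 2 by blast
qed

lemma square_card:
  assumes "square S s"
  shows "finite S" "card S = 4"
proof -
  from assms obtain a u v where S: "S = {a, a + u, a + u + v, a + v}"
    and "u \<noteq> 0" "v \<noteq> 0" "u \<noteq> v" "u + v \<noteq> 0"
    by (rule square_points)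
  then show "finite S" "card S = 4"
    by (auto simp: add.assoc)
qed

lemma square_right_angle:
  assumes "square S s" "p \<in> S" "q \<in> S" "r \<in> S" "p \<noteq> q" "q \<noteq> r" "p \<noteq> r"
  shows "(p - r) \<bullet> (q - r) = 0 \<or> (p - q) \<bullet> (r - q) = 0 \<or> (q - p) \<bullet> (r - p) = 0"
proof -
  from assms(1) obtain a u v where S: "S = {a, a + u, a + u + v, a + v}" and o: "u \<bullet> v = 0"
    by (rule square_points)
  have o': "v \<bullet> u = 0"
    using o by (simp add: inner_commute)
  show ?thesis
    using assms(2-7) unfolding S by (elim insertE emptyE; simp add: algebra_simps o o')
qed

lemma square_fourth:
  assumes "square S s" "p \<in> S" "q \<in> S" "r \<in> S" "p \<noteq> q" "q \<noteq> r" "p \<noteq> r"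
    and "(p - r) \<bullet> (q - r) = 0"
  shows "S = {p, q, r, p + q - r}"
proof -
  from assms(1) obtain a u v where S: "S = {a, a + u, a + u + v, a + v}" and o: "u \<bullet> v = 0"
    and uv: "u \<bullet> u = s\<^sup>2" "v \<bullet> v = s\<^sup>2" and s: "s > 0"
    by (rule square_points)
  have o': "v \<bullet> u = 0"
    using o by (simp add: inner_commute)
  have "p + q - r \<in> S"
    using assms(2-8) s unfolding S
    by (elim insertE emptyE; simp add: inner_simps algebra_simps o o' uv)
  moreover have "p + q - r \<noteq> p" "p + q - r \<noteq> q"
    using assms by auto
  moreover have "p + q - r \<noteq> r"
  proof
    assume "p + q - r = r"
    then have "q - r = - (p - r)"
      by (simp add: algebra_simps)
    then have "(p - r) \<bullet> (p - r) = 0"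
      using assms(8) by (simp only: inner_minus_right neg_equal_0_iff_equal)
    then show False
      using assms(7) by simp
  qed
  ultimately have "card {p, q, r, p + q - r} = 4" "{p, q, r, p + q - r} \<subseteq> S"
    using assms(2-7) by auto
  then show ?thesis
    using square_card[OF assms(1)] by (metis card_subset_eq)
qed

lemma square_three_points:
  assumes "square S s" "square S' s'" "p \<in> S \<inter> S'" "q \<in> S \<inter> S'" "r \<in> S \<inter> S'"
    "p \<noteq> q" "q \<noteq> r" "p \<noteq> r"
  shows "S = S'"
proof -
  have *: "p \<in> S" "q \<in> S" "r \<in> S" "p \<in> S'" "q \<in> S'" "r \<in> S'"
    using assms by auto
  have ne: "p \<noteq> q" "q \<noteq> r" "p \<noteq> r" "q \<noteq> p" "r \<noteq> q" "r \<noteq> p"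
    using assms by auto
  consider "(p - r) \<bullet> (q - r) = 0" | "(p - q) \<bullet> (r - q) = 0" | "(q - p) \<bullet> (r - p) = 0"
    using square_right_angle[OF assms(1) *(1-3) ne(1-3)] by argo
  then show ?thesis
  proof cases
    case 1
    then show ?thesis
      using square_fourth[OF assms(1), of p q r] square_fourth[OF assms(2), of p q r] * ne
      by argo
  next
    case 2
    then show ?thesis
      using square_fourth[OF assms(1), of p r q] square_fourth[OF assms(2), of p r q] * ne
      by argo
  next
    case 3
    then show ?thesis
      using square_fourth[OF assms(1), of q r p] square_fourth[OF assms(2), of q r p] * ne
      by argo
  qed
qed

lemma square_not_equilateral:
  assumes "square S s" "equilateral_triangle T s'"
  shows "\<not> T \<subseteq> S"
proof
  assume "T \<subseteq> S"
  obtain p q r where T: "T = {p, q, r}" and pos: "s' > 0"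
    and d: "dist p q = s'" "dist q r = s'" "dist r p = s'"
    using assms(2) unfolding equilateral_triangle_def by blast
  have ne: "p \<noteq> q" "q \<noteq> r" "p \<noteq> r"
    using pos d by auto
  have d2: "(p - q) \<bullet> (p - q) = s'\<^sup>2" "(q - r) \<bullet> (q - r) = s'\<^sup>2" "(r - p) \<bullet> (r - p) = s'\<^sup>2"
    using d by (simp_all add: dist_norm flip: power2_norm_eq_inner)
  have "s'\<^sup>2 > 0"
    using pos by simp
  moreover have "(p - r) \<bullet> (q - r) = 0 \<or> (p - q) \<bullet> (r - q) = 0 \<or> (q - p) \<bullet> (r - p) = 0"
    using square_right_angle[OF assms(1)] ne \<open>T \<subseteq> S\<close> T by simp
  moreover have "2 * ((p - r) \<bullet> (q - r)) = s'\<^sup>2" "2 * ((p - q) \<bullet> (r - q)) = s'\<^sup>2"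
    "2 * ((q - p) \<bullet> (r - p)) = s'\<^sup>2"
    using d2 by (simp_all add: inner_diff_left inner_diff_right inner_commute)
  ultimately show False
    by linarith
qed

lemma square_side:
  assumes "square S s" "a \<in> S" "b \<in> S" "p \<in> S" "q \<in> S" "a \<noteq> b" "a \<noteq> p" "a \<noteq> q"
    "b \<noteq> p" "b \<noteq> q" "p \<noteq> q"
  shows "(p - q) \<bullet> (p - q) = 2 * s\<^sup>2 \<and> (a - b) \<bullet> (a - b) = 2 * s\<^sup>2 \<or>
    (p - q) \<bullet> (p - q) = s\<^sup>2 \<and>
    (p - a = q - b \<and> (p - a) \<bullet> (p - a) = s\<^sup>2 \<and> (p - a) \<bullet> (a - b) = 0 \<or>
     q - a = p - b \<and> (q - a) \<bullet> (q - a) = s\<^sup>2 \<and> (q - a) \<bullet> (a - b) = 0)"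
proof -
  from assms(1) obtain c u v where S: "S = {c, c + u, c + u + v, c + v}" and o: "u \<bullet> v = 0"
    and uv: "u \<bullet> u = s\<^sup>2" "v \<bullet> v = s\<^sup>2"
    by (rule square_points)
  have o': "v \<bullet> u = 0"
    using o by (simp add: inner_commute)
  show ?thesis
    using assms(2-11) unfolding S
    by (elim insertE emptyE; simp add: inner_add_left inner_add_right inner_diff_left
        inner_diff_right o o' uv algebra_simps)
qed

lemma planar_orthogonal:
  fixes w w' d :: point
  assumes "w \<bullet> w = r" "w' \<bullet> w' = r" "w \<bullet> d = 0" "w' \<bullet> d = 0" "d \<noteq> 0"
  shows "w' = w \<or> w' = - w"
proof -
  have d: "d $ 1 \<noteq> 0 \<or> d $ 2 \<noteq> 0"
    using assms(5) by (simp add: vec_eq_iff forall_2)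
  have *: "w $ 1 * w $ 1 + w $ 2 * w $ 2 = r" "w' $ 1 * w' $ 1 + w' $ 2 * w' $ 2 = r"
    "w $ 1 * d $ 1 + w $ 2 * d $ 2 = 0" "w' $ 1 * d $ 1 + w' $ 2 * d $ 2 = 0"
    using assms by (simp_all add: inner_vec_def sum_2)
  have "(w $ 1 * w' $ 2 - w $ 2 * w' $ 1) * d $ 1 =
      w' $ 2 * (w $ 1 * d $ 1 + w $ 2 * d $ 2) - w $ 2 * (w' $ 1 * d $ 1 + w' $ 2 * d $ 2)"
    "(w $ 1 * w' $ 2 - w $ 2 * w' $ 1) * d $ 2 =
      w $ 1 * (w' $ 1 * d $ 1 + w' $ 2 * d $ 2) - w' $ 1 * (w $ 1 * d $ 1 + w $ 2 * d $ 2)"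
    by (simp_all add: algebra_simps)
  then have cross: "w $ 1 * w' $ 2 - w $ 2 * w' $ 1 = 0"
    unfolding *(3,4) using d by auto
  have "(w \<bullet> w')\<^sup>2 + (w $ 1 * w' $ 2 - w $ 2 * w' $ 1)\<^sup>2 =
      (w $ 1 * w $ 1 + w $ 2 * w $ 2) * (w' $ 1 * w' $ 1 + w' $ 2 * w' $ 2)"
    by (simp add: inner_vec_def sum_2 power2_eq_square algebra_simps)
  then have "(w \<bullet> w')\<^sup>2 = r\<^sup>2"
    unfolding *(1,2) cross by (simp add: power2_eq_square)
  then consider "w \<bullet> w' = r" | "w \<bullet> w' = - r"
    by (auto simp: power2_eq_iff)
  then show ?thesis
  proof cases
    case 1
    then have "(w' - w) \<bullet> (w' - w) = 0"
      using assms(1,2) by (simp only: inner_diff_left inner_diff_right inner_commute[of w' w])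
    then show ?thesis by simp
  next
    case 2
    then have "(w' + w) \<bullet> (w' + w) = 0"
      using assms(1,2) by (simp only: inner_add_left inner_add_right inner_commute[of w' w])
    then show ?thesis by (simp add: eq_neg_iff_add_eq_0)
  qed
qed

lemma glued_squares:
  assumes "square S s" "S = {a, b, p, q}" "card S = 4"
    and "square S' s" "S' = {a, b, p', q'}" "card S' = 4"
    and "{p, q} \<inter> {p', q'} = {}"
    and "(p - q) \<bullet> (p - q) = s\<^sup>2" "(p' - q') \<bullet> (p' - q') = s\<^sup>2"
    and "(c - p) \<bullet> (c - p) = s\<^sup>2" "(c - q) \<bullet> (c - q) = s\<^sup>2"
      "(c - p') \<bullet> (c - p') = s\<^sup>2" "(c - q') \<bullet> (c - q') = s\<^sup>2"
  shows "c = a"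
proof -
  have ne: "a \<noteq> b" "a \<noteq> p" "a \<noteq> q" "b \<noteq> p" "b \<noteq> q" "p \<noteq> q"
    "a \<noteq> p'" "a \<noteq> q'" "b \<noteq> p'" "b \<noteq> q'" "p' \<noteq> q'"
    using assms(2,3,5,6) by (auto simp: card_insert_if split: if_splits)
  have s: "s\<^sup>2 \<noteq> 0"
    using assms(1) by (auto simp: square_def)
  have "\<exists>w. {p, q} = {a + w, b + w} \<and> w \<bullet> w = s\<^sup>2 \<and> w \<bullet> (a - b) = 0"
  proof -
    have "p - a = q - b \<and> (p - a) \<bullet> (p - a) = s\<^sup>2 \<and> (p - a) \<bullet> (a - b) = 0 \<or>
     q - a = p - b \<and> (q - a) \<bullet> (q - a) = s\<^sup>2 \<and> (q - a) \<bullet> (a - b) = 0"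
      using square_side[OF assms(1), of a b p q] assms(2,8) ne s by simp
    moreover have "{p, q} = {a + (p - a), b + (p - a)}" if "p - a = q - b"
    proof -
      have "b + (p - a) = q"
        using that by simp
      then show ?thesis
        by (simp add: insert_commute)
    qed
    moreover have "{p, q} = {a + (q - a), b + (q - a)}" if "q - a = p - b"
    proof -
      have "b + (q - a) = p"
        using that by simp
      then show ?thesis
        by (simp add: insert_commute)
    qed
    ultimately show ?thesis
      by blast
  qed
  then obtain w where w: "{p, q} = {a + w, b + w}" "w \<bullet> w = s\<^sup>2" "w \<bullet> (a - b) = 0"
    by blast
  have "\<exists>w. {p', q'} = {a + w, b + w} \<and> w \<bullet> w = s\<^sup>2 \<and> w \<bullet> (a - b) = 0"
  proof -
    have "p' - a = q' - b \<and> (p' - a) \<bullet> (p' - a) = s\<^sup>2 \<and> (p' - a) \<bullet> (a - b) = 0 \<or>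
     q' - a = p' - b \<and> (q' - a) \<bullet> (q' - a) = s\<^sup>2 \<and> (q' - a) \<bullet> (a - b) = 0"
      using square_side[OF assms(4), of a b p' q'] assms(5,9) ne s by simp
    moreover have "{p', q'} = {a + (p' - a), b + (p' - a)}" if "p' - a = q' - b"
    proof -
      have "b + (p' - a) = q'"
        using that by simp
      then show ?thesis
        by (simp add: insert_commute)
    qed
    moreover have "{p', q'} = {a + (q' - a), b + (q' - a)}" if "q' - a = p' - b"
    proof -
      have "b + (q' - a) = p'"
        using that by simp
      then show ?thesis
        by (simp add: insert_commute)
    qed
    ultimately show ?thesis
      by blast
  qed
  then obtain w' where w': "{p', q'} = {a + w', b + w'}" "w' \<bullet> w' = s\<^sup>2" "w' \<bullet> (a - b) = 0"
    by blast
  have "w' \<noteq> w"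
    using w(1) w'(1) assms(7) by auto
  then have w'_eq: "w' = - w"
    using planar_orthogonal[OF w(2) w'(2) w(3) w'(3)] ne(1) by simp
  have all: "(c - x) \<bullet> (c - x) = s\<^sup>2" if "x \<in> {p, q} \<union> {p', q'}" for x
    using that assms(10-13) by auto
  have "a + w \<in> {p, q} \<union> {p', q'}" "a + w' \<in> {p, q} \<union> {p', q'}"
    using w(1) w'(1) by simp_all
  from this[THEN all] have "((c - a) - w) \<bullet> ((c - a) - w) = s\<^sup>2" "((c - a) + w) \<bullet> ((c - a) + w) = s\<^sup>2"
    by (simp_all add: w'_eq algebra_simps)
  then have "(c - a) \<bullet> (c - a) = 0"
    using w(2)
    by (simp only: inner_diff_left[of "c - a" w] inner_diff_right[of _ "c - a" w]
        inner_add_left[of "c - a" w] inner_add_right[of _ "c - a" w] inner_commute[of w "c - a"])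
  then show ?thesis
    by simp
qed

lemma triangle_square_sets:
  assumes "triangle_square P T S"
  shows "set_mset P = T \<union> S" "T \<inter> S = {}" "finite T" "finite S" "card T = 3" "card S = 4"
proof -
  from assms obtain s where *: "P = mset_set T + mset_set S" "equilateral_triangle T s"
    "square S s" "convex hull T \<inter> convex hull S = {}"
    unfolding triangle_square_def by blast
  show "finite T" "finite S" "card T = 3" "card S = 4"
    using equilateral_triangle_card[OF *(2)] square_card[OF *(3)] by auto
  then show "set_mset P = T \<union> S"
    using *(1) by simp
  show "T \<inter> S = {}"
    using *(4) hull_subset[of T convex] hull_subset[of S convex] by blast
qed

lemma triangle_square_unique:
  assumes "triangle_square P T S" "triangle_square P T' S'"
  shows "T = T'" "S = S'"
proof -
  note A = triangle_square_sets[OF assms(1)] and B = triangle_square_sets[OF assms(2)]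
  have un: "T \<union> S = T' \<union> S'"
    using A(1) B(1) by simp
  obtain s where s: "equilateral_triangle T s" "square S s"
    using assms(1) unfolding triangle_square_def by blast
  obtain s' where s': "equilateral_triangle T' s'" "square S' s'"
    using assms(2) unfolding triangle_square_def by blast
  have "S = S'"
  proof (rule ccontr)
    assume "S \<noteq> S'"
    have "card (S \<inter> S') \<le> 2"
    proof (rule ccontr)
      assume "\<not> card (S \<inter> S') \<le> 2"
      then have "3 \<le> card (S \<inter> S')"
        by linarith
      then obtain X where X: "X \<subseteq> S \<inter> S'" "card X = 3"
        by (rule obtain_subset_with_card_n)
      from X(2) obtain p q r where pqr: "X = {p, q, r}" "p \<noteq> q" "q \<noteq> r" "p \<noteq> r"
        unfolding card_3_iff by blast
      have "p \<in> S \<inter> S'" "q \<in> S \<inter> S'" "r \<in> S \<inter> S'"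
        using X(1) unfolding pqr(1) by simp_all
      with square_three_points[OF s(2) s'(2)] pqr(2-4) have "S = S'"
        by metis
      with \<open>S \<noteq> S'\<close> show False
        by simp
    qed
    have S_split: "S = (S \<inter> S') \<union> (S \<inter> T')" and S'_split: "S' = (S \<inter> S') \<union> (T \<inter> S')"
      and T'_split: "T' = (T \<inter> T') \<union> (S \<inter> T')"
      using un by blast+
    have cT: "card (S \<inter> T') + card (S \<inter> S') = 4"
    proof -
      have "card ((S \<inter> T') \<union> (S \<inter> S')) = card (S \<inter> T') + card (S \<inter> S')"
        using A B by (intro card_Un_disjoint) auto
      then show ?thesis
        using A(6) S_split by (simp add: Un_commute)
    qed
    have cT': "card (T \<inter> S') + card (S \<inter> S') = 4"
    proof -
      have "card ((T \<inter> S') \<union> (S \<inter> S')) = card (T \<inter> S') + card (S \<inter> S')"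
        using A B by (intro card_Un_disjoint) auto
      then show ?thesis
        using B(6) S'_split by (simp add: Un_commute)
    qed
    have cTT: "card (T \<inter> T') + card (S \<inter> T') = 3"
    proof -
      have "card ((T \<inter> T') \<union> (S \<inter> T')) = card (T \<inter> T') + card (S \<inter> T')"
        using A B by (intro card_Un_disjoint) auto
      then show ?thesis
        using B(5) T'_split by (simp add: Un_commute)
    qed
    have "card (S \<inter> T') \<noteq> 3"
    proof
      assume "card (S \<inter> T') = 3"
      then have "S \<inter> T' = T'"
        using B(3,5) by (intro card_subset_eq) auto
      then show False
        using square_not_equilateral[OF s(2) s'(1)] by blast
    qed
    then have c: "card (S \<inter> S') = 2" "card (S \<inter> T') = 2" "card (T \<inter> S') = 2" "card (T \<inter> T') = 1"
      using cT cT' cTT \<open>card (S \<inter> S') \<le> 2\<close> by linarith+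
    obtain a b where ab: "S \<inter> S' = {a, b}" "a \<noteq> b"
      using c(1) by (auto simp: card_2_iff)
    obtain p q where pq: "S \<inter> T' = {p, q}" "p \<noteq> q"
      using c(2) by (auto simp: card_2_iff)
    obtain p' q' where pq': "T \<inter> S' = {p', q'}" "p' \<noteq> q'"
      using c(3) by (auto simp: card_2_iff)
    obtain x where x: "T \<inter> T' = {x}"
      using c(4) by (auto simp: card_1_singleton_iff)
    have S: "S = {a, b, p, q}"
      using S_split unfolding ab(1) pq(1) by blast
    have S': "S' = {a, b, p', q'}"
      using S'_split unfolding ab(1) pq'(1) by blast
    have "a \<in> S \<inter> S'" "b \<in> S \<inter> S'" "p \<in> S \<inter> T'" "q \<in> S \<inter> T'" "p' \<in> T \<inter> S'" "q' \<in> T \<inter> S'"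
      "x \<in> T \<inter> T'"
      unfolding ab(1) pq(1) pq'(1) x by simp_all
    then have mem: "a \<in> S" "a \<in> S'" "b \<in> S" "b \<in> S'" "p \<in> S" "p \<in> T'" "q \<in> S" "q \<in> T'"
      "p' \<in> T" "p' \<in> S'" "q' \<in> T" "q' \<in> S'" "x \<in> T" "x \<in> T'"
      by simp_all
    have neq: "y \<noteq> z" if "y \<in> T \<and> z \<in> S \<or> y \<in> S \<and> z \<in> T \<or> y \<in> T' \<and> z \<in> S' \<or> y \<in> S' \<and> z \<in> T'" for y z
      using that A(2) B(2) by blast
    have distinct: "a \<noteq> p" "a \<noteq> q" "b \<noteq> p" "b \<noteq> q" "a \<noteq> p'" "a \<noteq> q'" "b \<noteq> p'" "b \<noteq> q'"
      "x \<noteq> p" "x \<noteq> q" "x \<noteq> p'" "x \<noteq> q'" "x \<noteq> a"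
      by (rule neq, simp add: mem)+
    have tri: "(y - z) \<bullet> (y - z) = r\<^sup>2" if "equilateral_triangle U r" "y \<in> U" "z \<in> U" "y \<noteq> z"
      for U r y z
      using equilateral_triangle_dist[OF that] by (simp add: dist_norm flip: power2_norm_eq_inner)
    have d: "(p - q) \<bullet> (p - q) = s'\<^sup>2" "(x - p) \<bullet> (x - p) = s'\<^sup>2" "(x - q) \<bullet> (x - q) = s'\<^sup>2"
      by (rule tri[OF s'(1)]; fact)+
    have d': "(p' - q') \<bullet> (p' - q') = s\<^sup>2" "(x - p') \<bullet> (x - p') = s\<^sup>2" "(x - q') \<bullet> (x - q') = s\<^sup>2"
      by (rule tri[OF s(1)]; fact)+
    have pos: "s > 0" "s' > 0"
      using s s' by (auto simp: square_def)
    have "s'\<^sup>2 = 2 * s\<^sup>2 \<or> s'\<^sup>2 = s\<^sup>2"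
      using square_side[OF s(2) mem(1,3,5,7) ab(2) distinct(1-4) pq(2)] d(1) by argo
    moreover have "s\<^sup>2 = 2 * s'\<^sup>2 \<or> s\<^sup>2 = s'\<^sup>2"
      using square_side[OF s'(2) mem(2,4,10,12) ab(2) distinct(5-8) pq'(2)] d'(1) by argo
    moreover have "s\<^sup>2 > 0"
      using pos by simp
    ultimately have "s'\<^sup>2 = s\<^sup>2"
      by linarith
    then have eq: "s' = s"
      using pos by simp
    have "{p, q} \<inter> {p', q'} = {}"
      using A(2) unfolding pq(1)[symmetric] pq'(1)[symmetric] by blast
    from glued_squares[OF s(2) S A(6) s'(2)[unfolded eq] S' B(6) this d(1)[unfolded eq] d'(1)
        d(2,3)[unfolded eq] d'(2,3)]
    have "x = a" .
    with distinct show False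
      by simp
  qed
  moreover have "T = (T \<union> S) - S" "T' = (T' \<union> S') - S'"
    using A(2) B(2) by blast+
  ultimately show "T = T'" "S = S'"
    using un by simp_all
qed

lemma triangle_part_eq: "triangle_square P T S \<Longrightarrow> triangle_part P = T"
  unfolding triangle_part_def by (rule the_equality) (auto dest: triangle_square_unique)

lemma square_part_eq: "triangle_square P T S \<Longrightarrow> square_part P = S"
  unfolding square_part_def by (rule the_equality) (auto dest: triangle_square_unique)

end

theory Submission imports Defs begin

text \<open>Consider one coordinate \<open>k\<close> of an execution of \<open>phi_T\<close> alone (or of \<open>phi_S\<close> alone). All targets
  lie in the convex hull of the configuration, so the maximum decreases to some \<open>M\<close> and the minimum
  increases to some \<open>m\<close>. Suppose \<open>m < M\<close>. A move to the center of gravity eventually ends at depth at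
  least a fixed \<open>c > 0\<close> inside \<open>[m, M]\<close>, and a move towards the center of the own figure ends at depth
  proportional to the side length \<open>s\<close>. The point is that \<open>s\<close> stays bounded away from \<open>0\<close>: if a robot at
  depth \<open>c\<close> belongs to a triangle and a square whose union spans \<open>[m, M]\<close>, then \<open>s \<ge> c / 2\<close>; and if
  only own-figure moves occur in a step after which the configuration is again a triangle and a square,
  then \<open>s\<close> has not decreased, because the figure that did not move is shared between the new triangle
  and the new square. Hence every move eventually ends at depth at least a fixed positive constant, and
  by fairness all robots leave the neighbourhood of \<open>M\<close>, a contradiction.

  If the triangle robots use \<open>phi_T\<close> and the square robots \<open>phi_S\<close>, and all are always active, both
  figures are halved at each step and converge to two different centers.\<close>

section \<open>Similarity invariance and the possible moves\<close>

text \<open>The condition \<open>\<Psi>\<close> in global coordinates, where the origin need not be occupied.\<close>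

definition tri_sq :: "point multiset \<Rightarrow> point set \<Rightarrow> point set \<Rightarrow> real \<Rightarrow> bool" where
  "tri_sq P T S s \<longleftrightarrow> P = mset_set T + mset_set S \<and> equilateral_triangle T s \<and> square S s \<and>
     convex hull T \<inter> convex hull S = {}"

lemma triangle_square_iff: "triangle_square P T S \<longleftrightarrow> 0 \<in># P \<and> (\<exists>s. tri_sq P T S s)"
  using equilateral_triangle_card[of T] square_card[of S]
  by (auto simp: triangle_square_def tri_sq_def)

section \<open>Effect of frames on triangles, squares and decompositions\<close>

lemma to_global_inner:
  assumes "local_frame Z"
  shows "(to_global Z o1 p - to_global Z o1 q) \<bullet> (to_global Z o1 p' - to_global Z o1 q') =
    (fst Z)\<^sup>2 * ((p - q) \<bullet> (p' - q'))"
proof -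
  have "orthogonal_transformation ((*v) (snd Z))"
    using assms by (simp add: local_frame_def rotation_matrix_def orthogonal_transformation_matrix
        matrix_vector_mul_linear)
  then have "(snd Z *v (p - q)) \<bullet> (snd Z *v (p' - q')) = (p - q) \<bullet> (p' - q')"
    by (simp add: orthogonal_transformation_def)
  moreover have "to_global Z o1 p - to_global Z o1 q = fst Z *\<^sub>R (snd Z *v (p - q))" for p q
    by (simp add: to_global_def matrix_vector_mult_diff_distrib scaleR_diff_right)
  ultimately show ?thesis
    by (simp add: power2_eq_square)
qed

lemma dist_to_global:
  assumes "local_frame Z"
  shows "dist (to_global Z o1 p) (to_global Z o1 q) = fst Z * dist p q"
  using assms to_global_inner[OF assms, of o1 p q p q]
  by (simp add: dist_norm norm_eq_sqrt_inner real_sqrt_mult local_frame_def)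

lemma inj_to_global: "local_frame Z \<Longrightarrow> inj (to_global Z o1)"
  using dist_to_global[of Z o1] by (metis injI dist_eq_0_iff mult_eq_0_iff local_frame_def less_irrefl)

text \<open>The inverse of a similarity is a similarity with reciprocal unit and transposed
  rotation. A local view is thus itself the image under a frame, so the invariance lemmas apply in
  both directions.\<close>

lemma inv_to_global:
  assumes "local_frame Z"
  obtains Z' o' where "local_frame Z'" "inv (to_global Z o1) = to_global Z' o'"
    "\<And>p. to_global Z o1 (to_global Z' o' p) = p"
proof -
  define Z' where "Z' = (1 / fst Z, transpose (snd Z))"
  \<comment> \<open>\<open>o'\<close> is the local image of the global origin; it cancels the shift
    by \<open>o1\<close>.\<close>
  define o' where "o' = (- 1 / fst Z) *\<^sub>R (transpose (snd Z) *v o1)"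
  from assms have Z: "fst Z > 0" "snd Z ** transpose (snd Z) = mat 1" "rotation_matrix (snd Z)"
    by (auto simp: local_frame_def rotation_matrix_def orthogonal_matrix_def)
  have "local_frame Z'"
    using Z by (simp add: Z'_def local_frame_def rotation_matrix_def)
  moreover have *: "to_global Z o1 (to_global Z' o' p) = p" for p
    using Z by (simp add: to_global_def Z'_def o'_def matrix_vector_right_distrib scaleR_add_right
        matrix_vector_mult_scaleR matrix_vector_mul_assoc scaleR_diff_right
        matrix_vector_mult_diff_distrib del: transpose_matrix_vector)
  moreover have "inv (to_global Z o1) = to_global Z' o'"
    using inj_to_global[OF assms] * by (metis inv_f_f ext)
  ultimately show thesis
    using that by blast
qed

lemma to_global_affine:
  "to_global Z o1 (p + u) = to_global Z o1 p + fst Z *\<^sub>R (snd Z *v u)"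
  by (simp add: to_global_def matrix_vector_right_distrib scaleR_add_right)

lemma equilateral_triangle_to_global:
  assumes "local_frame Z" "equilateral_triangle T s"
  shows "equilateral_triangle (to_global Z o1 ` T) (fst Z * s)"
proof -
  obtain a b c where "s > 0" "T = {a, b, c}" "dist a b = s" "dist b c = s" "dist c a = s"
    using assms(2) unfolding equilateral_triangle_def by blast
  then show ?thesis
    unfolding equilateral_triangle_def using assms(1)
    by (intro conjI exI[of _ "to_global Z o1 a"] exI[of _ "to_global Z o1 b"]
        exI[of _ "to_global Z o1 c"]) (auto simp: dist_to_global local_frame_def)
qed

lemma square_to_global:
  assumes "local_frame Z" "square S s"
  shows "square (to_global Z o1 ` S) (fst Z * s)"
proof -
  obtain a u v where *: "s > 0" "S = {a, a + u, a + u + v, a + v}" "norm u = s" "norm v = s"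
    "u \<bullet> v = 0"
    using assms(2) unfolding square_def by blast
  let ?g = "to_global Z o1"
  have "dist (?g (a + u)) (?g a) = fst Z * s" "dist (?g (a + v)) (?g a) = fst Z * s"
    "(?g (a + u) - ?g a) \<bullet> (?g (a + v) - ?g a) = 0"
    using * assms(1) by (simp_all only: dist_to_global to_global_inner) (simp_all add: dist_norm)
  then have "norm (fst Z *\<^sub>R (snd Z *v u)) = fst Z * s" "norm (fst Z *\<^sub>R (snd Z *v v)) = fst Z * s"
    "(fst Z *\<^sub>R (snd Z *v u)) \<bullet> (fst Z *\<^sub>R (snd Z *v v)) = 0"
    by (simp_all only: to_global_affine dist_norm add_diff_cancel_left')
  moreover have "?g ` S = {?g a, ?g a + fst Z *\<^sub>R (snd Z *v u),
     ?g a + fst Z *\<^sub>R (snd Z *v u) + fst Z *\<^sub>R (snd Z *v v), ?g a + fst Z *\<^sub>R (snd Z *v v)}"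
    by (simp add: *(2) to_global_affine)
  ultimately show ?thesis
    unfolding square_def using assms(1) *(1)
    by (intro conjI exI[of _ "?g a"] exI[of _ "fst Z *\<^sub>R (snd Z *v u)"]
        exI[of _ "fst Z *\<^sub>R (snd Z *v v)"]) (simp_all add: local_frame_def)
qed

lemma convex_hull_to_global:
  "convex hull (to_global Z o1 ` X) = to_global Z o1 ` (convex hull X)"
proof -
  have "linear (\<lambda>y. fst Z *\<^sub>R (snd Z *v y))"
    by (intro linear_compose_scale_right matrix_vector_mul_linear)
  from convex_hull_linear_image[OF this, of X] have
    "convex hull ((\<lambda>y. o1 + y) ` (\<lambda>y. fst Z *\<^sub>R (snd Z *v y)) ` X) =
      (\<lambda>y. o1 + y) ` (\<lambda>y. fst Z *\<^sub>R (snd Z *v y)) ` (convex hull X)"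
    by (simp add: convex_hull_translation)
  then show ?thesis
    by (simp add: image_image to_global_def)
qed

lemma tri_sq_to_global:
  assumes Z: "local_frame Z" and "tri_sq P T S s"
  shows "tri_sq (image_mset (to_global Z o1) P) (to_global Z o1 ` T) (to_global Z o1 ` S) (fst Z * s)"
  using assms(2) inj_to_global[OF Z, of o1]
    equilateral_triangle_to_global[OF Z, of T s o1] square_to_global[OF Z, of S s o1]
  by (simp add: tri_sq_def convex_hull_to_global image_mset_mset_set inj_on_subset
      flip: image_Int)

lemma center_of_gravity_to_global:
  assumes "Q \<noteq> {#}"
  shows "center_of_gravity (image_mset (to_global Z o1) Q) = to_global Z o1 (center_of_gravity Q)"
proof -
  have "sum_mset (image_mset (to_global Z o1) Q) =
      real (size Q) *\<^sub>R o1 + fst Z *\<^sub>R (snd Z *v sum_mset Q)"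
    by (induction Q) (simp_all add: to_global_def algebra_simps)
  moreover have "real (size Q) \<noteq> 0"
    using assms by simp
  ultimately show ?thesis
    by (simp add: center_of_gravity_def to_global_def scaleR_add_right matrix_vector_mult_scaleR
        mult.commute)
qed

text \<open>\<open>triangle_square_unique\<close> speaks of configurations that occupy the origin,
  so a vertex \<open>p\<close> of \<open>T\<close> is first translated to \<open>0\<close>. The side
  is then recovered as a distance inside the common triangle.\<close>

lemma tri_sq_unique:
  assumes "tri_sq P T S s" "tri_sq P T' S' s'"
  shows "T = T'" "S = S'" "s = s'"
proof -
  have Z: "local_frame (1, mat 1)"
    by (simp add: local_frame_def rotation_matrix_def orthogonal_matrix_def)
  obtain p where p: "p \<in> T"
    using assms(1) unfolding tri_sq_def equilateral_triangle_def by blast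
  let ?g = "to_global (1, mat 1) (- p)"
  have "p \<in># P"
    using p equilateral_triangle_card(1)[of T] assms(1) by (auto simp: tri_sq_def)
  moreover have "?g p = 0"
    by (simp add: to_global_def)
  ultimately have 0: "0 \<in># image_mset ?g P"
    by force
  have "triangle_square (image_mset ?g P) (?g ` T) (?g ` S)"
    "triangle_square (image_mset ?g P) (?g ` T') (?g ` S')"
    using 0 tri_sq_to_global[OF Z assms(1)] tri_sq_to_global[OF Z assms(2)]
    unfolding triangle_square_iff by blast+
  from triangle_square_unique[OF this] show TS: "T = T'" "S = S'"
    using inj_to_global[OF Z] by (simp_all add: inj_image_eq_iff)
  from assms(1) obtain a b where "a \<in> T" "b \<in> T" "dist a b = s" "a \<noteq> b"
    unfolding tri_sq_def equilateral_triangle_def by force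
  then show "s = s'"
    using assms(2) TS equilateral_triangle_dist unfolding tri_sq_def by metis
qed

text \<open>A dictionary between \<open>P\<close> and what a robot at \<open>x\<close> sees of it.
  The robot is at its own origin, so \<open>0\<close> stands for \<open>x\<close> in the local
  view.\<close>

lemma local_view:
  assumes Z: "local_frame Z" and x: "x \<in># P"
  defines "f \<equiv> inv (to_global Z x)"
  shows "0 \<in># image_mset f P"
    and "tri_sq P T S s \<Longrightarrow> triangle_square (image_mset f P) (f ` T) (f ` S)"
    and "triangle_square (image_mset f P) T' S' \<Longrightarrow>
      \<exists>s. tri_sq P (to_global Z x ` T') (to_global Z x ` S') s"
    and "Q \<noteq> {#} \<Longrightarrow> to_global Z x (center_of_gravity (image_mset f Q)) = center_of_gravity Q"
    and "0 \<in> f ` X \<longleftrightarrow> x \<in> X"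
proof -
  obtain Z' o' where Z': "local_frame Z'" and f: "f = to_global Z' o'"
    and inv: "\<And>p. to_global Z x (to_global Z' o' p) = p"
    using inv_to_global[OF Z] unfolding f_def by metis
  have "to_global Z x 0 = x"
    by (simp add: to_global_def)
  then have fx: "f x = 0"
    unfolding f_def using inj_to_global[OF Z] by (metis inv_f_f)
  show 0: "0 \<in># image_mset f P"
    using x fx by force
  show "triangle_square (image_mset f P) (f ` T) (f ` S)" if "tri_sq P T S s"
    using 0 tri_sq_to_global[OF Z' that] f unfolding triangle_square_iff by blast
  show "\<exists>s. tri_sq P (to_global Z x ` T') (to_global Z x ` S') s"
    if "triangle_square (image_mset f P) T' S'"
  proof -
    from that obtain s where "tri_sq (image_mset f P) T' S' s"
      unfolding triangle_square_iff by blast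
    from tri_sq_to_global[OF Z this, of x] show ?thesis
      by (auto simp: f inv image_mset.compositionality comp_def)
  qed
  show "to_global Z x (center_of_gravity (image_mset f Q)) = center_of_gravity Q" if "Q \<noteq> {#}"
    using that by (simp add: f center_of_gravity_to_global inv)
  have "inj f"
    unfolding f using inj_to_global[OF Z'] .
  then show "0 \<in> f ` X \<longleftrightarrow> x \<in> X"
    using fx by (metis inj_image_mem_iff)
qed

section \<open>The moves in global coordinates\<close>

lemma to_global_half: "to_global Z x (y /\<^sub>R 2) = midpoint x (to_global Z x y)"
  by (simp add: to_global_def midpoint_def matrix_vector_mult_scaleR vec_eq_iff field_simps)

text \<open>Uniqueness of the decomposition forces \<open>triangle_part\<close> of the local view to
  be the image of \<open>T\<close>. Since the robot is its own origin, halving the vector to the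
  center means going to the midpoint.\<close>

lemma phi_T_move:
  assumes Z: "local_frame Z" and x: "x \<in># P" and TS: "tri_sq P T S s" and T: "x \<in> T"
  shows "map_option (to_global Z x) (phi_T (image_mset (inv (to_global Z x)) P)) =
    Some (midpoint x (center_of_gravity (mset_set T)))"
proof -
  let ?f = "inv (to_global Z x)"
  note L = local_view[OF Z x]
  have "inj ?f"
    using inv_to_global[OF Z] inj_to_global by metis
  then have im: "mset_set (?f ` T) = image_mset ?f (mset_set T)"
    by (simp add: image_mset_mset_set inj_on_subset)
  have ne: "mset_set T \<noteq> {#}"
    using equilateral_triangle_card[of T s] TS by (auto simp: tri_sq_def mset_set_empty_iff)
  have "Psi (image_mset ?f P)"
    using L(2)[OF TS] unfolding Psi_def by blast
  then have "phi_T (image_mset ?f P) = Some (center_of_gravity (mset_set (?f ` T)) /\<^sub>R 2)"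
    using L(1) L(5)[of T] T unfolding phi_T_def triangle_part_eq[OF L(2)[OF TS]] by presburger
  then show ?thesis
    by (simp only: option.map to_global_half im L(4)[OF ne])
qed

lemma phi_S_move:
  assumes Z: "local_frame Z" and x: "x \<in># P" and TS: "tri_sq P T S s" and S: "x \<in> S"
  shows "map_option (to_global Z x) (phi_S (image_mset (inv (to_global Z x)) P)) =
    Some (midpoint x (center_of_gravity (mset_set S)))"
proof -
  let ?f = "inv (to_global Z x)"
  note L = local_view[OF Z x]
  have "inj ?f"
    using inv_to_global[OF Z] inj_to_global by metis
  then have im: "mset_set (?f ` S) = image_mset ?f (mset_set S)"
    by (simp add: image_mset_mset_set inj_on_subset)
  have ne: "mset_set S \<noteq> {#}"
    using square_card[of S s] TS by (auto simp: tri_sq_def mset_set_empty_iff)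
  have "Psi (image_mset ?f P)"
    using L(2)[OF TS] unfolding Psi_def by blast
  then have "phi_S (image_mset ?f P) = Some (center_of_gravity (mset_set (?f ` S)) /\<^sub>R 2)"
    using L(1) L(5)[of S] S unfolding phi_S_def square_part_eq[OF L(2)[OF TS]] by presburger
  then show ?thesis
    by (simp only: option.map to_global_half im L(4)[OF ne])
qed

text \<open>If the rule for the own triangle fires locally, the frame carries the local
  decomposition back to a global one with \<open>x\<close> in its triangle. Otherwise the target is
  the center of gravity.\<close>

lemma phi_T_cases:
  assumes Z: "local_frame Z" and x: "x \<in># P"
    and y: "Some y = map_option (to_global Z x) (phi_T (image_mset (inv (to_global Z x)) P))"
  obtains "y = center_of_gravity P"
  | T S s where "tri_sq P T S s" "x \<in> T" "y = midpoint x (center_of_gravity (mset_set T))"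
proof (cases "\<exists>T S s. tri_sq P T S s \<and> x \<in> T")
  case True
  with that(2) phi_T_move[OF Z x] y show ?thesis
    by (metis option.inject)
next
  case False
  note L = local_view[OF Z x]
  have "\<not> (Psi (image_mset (inv (to_global Z x)) P) \<and>
      0 \<in> triangle_part (image_mset (inv (to_global Z x)) P))"
  proof
    assume *: "Psi (image_mset (inv (to_global Z x)) P) \<and>
      0 \<in> triangle_part (image_mset (inv (to_global Z x)) P)"
    then obtain T S where TS: "triangle_square (image_mset (inv (to_global Z x)) P) T S"
      unfolding Psi_def by blast
    with * have "0 \<in> T"
      by (simp add: triangle_part_eq)
    then have "x \<in> to_global Z x ` T"
      by (force simp: to_global_def)
    with L(3)[OF TS] False show False
      by blast
  qed
  then have "phi_T (image_mset (inv (to_global Z x)) P) =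
      Some (center_of_gravity (image_mset (inv (to_global Z x)) P))"
    using L(1) unfolding phi_T_def by presburger
  moreover have "P \<noteq> {#}"
    using x by auto
  ultimately have "y = center_of_gravity P"
    using y L(4) by simp
  with that(1) show ?thesis .
qed

lemma phi_S_cases:
  assumes Z: "local_frame Z" and x: "x \<in># P"
    and y: "Some y = map_option (to_global Z x) (phi_S (image_mset (inv (to_global Z x)) P))"
  obtains "y = center_of_gravity P"
  | T S s where "tri_sq P T S s" "x \<in> S" "y = midpoint x (center_of_gravity (mset_set S))"
proof (cases "\<exists>T S s. tri_sq P T S s \<and> x \<in> S")
  case True
  with that(2) phi_S_move[OF Z x] y show ?thesis
    by (metis option.inject)
next
  case False
  note L = local_view[OF Z x]
  have "\<not> (Psi (image_mset (inv (to_global Z x)) P) \<and>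
      0 \<in> square_part (image_mset (inv (to_global Z x)) P))"
  proof
    assume *: "Psi (image_mset (inv (to_global Z x)) P) \<and>
      0 \<in> square_part (image_mset (inv (to_global Z x)) P)"
    then obtain T S where TS: "triangle_square (image_mset (inv (to_global Z x)) P) T S"
      unfolding Psi_def by blast
    with * have "0 \<in> S"
      by (simp add: square_part_eq)
    then have "x \<in> to_global Z x ` S"
      by (force simp: to_global_def)
    with L(3)[OF TS] False show False
      by blast
  qed
  then have "phi_S (image_mset (inv (to_global Z x)) P) =
      Some (center_of_gravity (image_mset (inv (to_global Z x)) P))"
    using L(1) unfolding phi_S_def by presburger
  moreover have "P \<noteq> {#}"
    using x by auto
  ultimately have "y = center_of_gravity P"
    using y L(4) by simp
  with that(1) show ?thesis .
qed

section \<open>The side length does not decrease\<close>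

lemma square_dist2:
  assumes "square S s" "p \<in> S" "q \<in> S" "p \<noteq> q"
  shows "(dist p q)\<^sup>2 = s\<^sup>2 \<or> (dist p q)\<^sup>2 = 2 * s\<^sup>2"
proof -
  from assms(1) obtain a u v where S: "S = {a, a + u, a + u + v, a + v}" and o: "u \<bullet> v = 0"
    and uv: "u \<bullet> u = s\<^sup>2" "v \<bullet> v = s\<^sup>2"
    by (rule square_points)
  have o': "v \<bullet> u = 0"
    using o by (simp add: inner_commute)
  show ?thesis
    using assms(2-4) unfolding S dist_norm power2_norm_eq_inner
    by (elim insertE emptyE; simp add: inner_add_left inner_add_right inner_diff_left
        inner_diff_right o o' uv algebra_simps)
qed

lemma square_dist_ge:
  assumes "square S s" "p \<in> S" "q \<in> S" "p \<noteq> q"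
  shows "s \<le> dist p q"
proof (rule power2_le_imp_le)
  show "s\<^sup>2 \<le> (dist p q)\<^sup>2"
    using square_dist2[OF assms] zero_le_power2[of s] by linarith
qed simp

lemma square_opposite_dist2:
  assumes "square S s" "S = {a, b, p, q}" "card S = 4" "(dist a b)\<^sup>2 = 2 * s\<^sup>2"
  shows "(dist p q)\<^sup>2 = 2 * s\<^sup>2"
proof -
  have ne: "a \<noteq> b" "a \<noteq> p" "a \<noteq> q" "b \<noteq> p" "b \<noteq> q" "p \<noteq> q"
    using assms(2,3) by (auto simp: card_insert_if split: if_splits)
  have "s\<^sup>2 \<noteq> 0"
    using assms(1) by (auto simp: square_def)
  then show ?thesis
    using square_side[OF assms(1), of p q a b] ne assms(2,4)
    by (auto simp: dist_norm power2_norm_eq_inner)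
qed

text \<open>Here \<open>e\<close> and \<open>f\<close> are the half diagonals. In this form a move
  halfway to the center just scales one of the four vectors by 1/2.\<close>

lemma square_cross:
  assumes "square S s"
  obtains e f where "S = {center_of_gravity (mset_set S) + e, center_of_gravity (mset_set S) - e,
      center_of_gravity (mset_set S) + f, center_of_gravity (mset_set S) - f}"
    "e \<bullet> e = s\<^sup>2 / 2" "f \<bullet> f = s\<^sup>2 / 2" "e \<bullet> f = 0"
proof -
  obtain a u v where S: "S = {a, a + u, a + u + v, a + v}"
    and uv: "u \<bullet> u = s\<^sup>2" "v \<bullet> v = s\<^sup>2" "u \<bullet> v = 0" and ne: "u \<noteq> 0" "v \<noteq> 0" "u \<noteq> v" "u + v \<noteq> 0"
    using square_points[OF assms] by metis
  define c where "c = a + (u + v) /\<^sub>R 2"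
  define e where "e = (u + v) /\<^sub>R 2"
  define f where "f = (u - v) /\<^sub>R 2"
  have "sum_mset (mset_set S) = (\<Sum>p\<in>S. p)"
    by (simp add: sum_unfold_sum_mset)
  also have "\<dots> = 4 *\<^sub>R c"
    using ne unfolding S c_def by (simp add: add.assoc) (simp add: algebra_simps vec_eq_iff)
  finally have "center_of_gravity (mset_set S) = c"
    using square_card[OF assms] by (simp add: center_of_gravity_def)
  moreover have "S = {c + e, c - e, c + f, c - f}"
  proof -
    have "c + e = a + u + v" "c - e = a" "c + f = a + u" "c - f = a + v"
      by (simp_all add: c_def e_def f_def vec_eq_iff field_simps)
    then show ?thesis
      unfolding S by auto
  qed
  moreover have "e \<bullet> e = s\<^sup>2 / 2" "f \<bullet> f = s\<^sup>2 / 2" "e \<bullet> f = 0"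
    using uv by (simp_all add: e_def f_def inner_simps inner_commute)
  ultimately show thesis
    using that by metis
qed

text \<open>The law of cosines for two points seen from \<open>c\<close>.\<close>

lemma cross_dist2:
  fixes c d d' :: "'a::real_inner"
  assumes "d \<bullet> d = r" "d' \<bullet> d' = r"
  shows "(dist (c + l *\<^sub>R d) (c + l' *\<^sub>R d'))\<^sup>2 = (l\<^sup>2 + l'\<^sup>2) * r - 2 * l * l' * (d \<bullet> d')"
  using assms unfolding dist_norm power2_norm_eq_inner
  by (simp add: inner_simps inner_commute[of d' d] power2_eq_square algebra_simps)

text \<open>The vertices of a square of side \<open>s\<close>, some of them moved halfway to its center, cannot be split
  into a pair at distance \<open>s\<close> and a pair at distance \<open>s / sqrt 2\<close>: the former would have to be adjacent
  and the latter opposite. Here \<open>r = s\<^sup>2 / 2\<close>.\<close>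

lemma cross_no_split:
  fixes c e f :: "'a::real_inner"
  assumes r: "r > 0" "e \<bullet> e = r" "f \<bullet> f = r" "e \<bullet> f = 0"
    and d: "{d1, d2, d3, d4} \<subseteq> {e, - e, f, - f}" "distinct [d1, d2, d3, d4]"
    and l: "{l1, l2, l3, l4} \<subseteq> {1, 1/2}"
    and "(dist (c + l1 *\<^sub>R d1) (c + l2 *\<^sub>R d2))\<^sup>2 = 2 * r"
  shows "(dist (c + l3 *\<^sub>R d3) (c + l4 *\<^sub>R d4))\<^sup>2 \<noteq> r"
proof -
  have fe: "f \<bullet> e = 0"
    using r by (simp add: inner_commute)
  have m: "d1 \<in> {e, - e, f, - f}" "d2 \<in> {e, - e, f, - f}" "d3 \<in> {e, - e, f, - f}" "d4 \<in> {e, - e, f, - f}"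
    using d(1) by auto
  have n: "d \<bullet> d = r" if "d \<in> {e, - e, f, - f}" for d
    using that r by auto
  have l': "l1 \<in> {1, 1/2}" "l2 \<in> {1, 1/2}" "l3 \<in> {1, 1/2}" "l4 \<in> {1, 1/2}"
    using l by auto
  have "d1 \<bullet> d2 = 0 \<or> d1 \<bullet> d2 = - r"
    using m(1,2) d(2) r fe by auto
  moreover have "(l1\<^sup>2 + l2\<^sup>2) * r - 2 * l1 * l2 * (d1 \<bullet> d2) = 2 * r"
    using assms(8) cross_dist2[OF n n] m by metis
  ultimately have "d1 \<bullet> d2 = 0 \<or> (l1 + l2)\<^sup>2 * r = 2 * r"
    by (auto simp: algebra_simps power2_eq_square)
  \<comment> \<open>This excludes an opposite first pair: \<open>l1 + l2\<close> can only be 1, 3/2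
    or 2.\<close>
  moreover have "(l1 + l2)\<^sup>2 \<noteq> 2"
    using l'(1,2) by (elim insertE emptyE; hypsubst; simp add: power2_eq_square)
  ultimately have o: "d1 \<bullet> d2 = 0"
    using r(1) by simp
  \<comment> \<open>The first pair takes one vector from each diagonal, so the second pair does
    too.\<close>
  have "d3 \<bullet> d4 = 0"
    using m d(2) o r fe by (elim insertE emptyE; simp)
  then have "(dist (c + l3 *\<^sub>R d3) (c + l4 *\<^sub>R d4))\<^sup>2 = (l3\<^sup>2 + l4\<^sup>2) * r"
    using cross_dist2[OF n[OF m(3)] n[OF m(4)], of c l3 l4] by simp
  \<comment> \<open>The possible values are 1/2, 5/4 and 2.\<close>
  moreover have "l3\<^sup>2 + l4\<^sup>2 \<noteq> 1"
    using l'(3,4) by (elim insertE emptyE; hypsubst; simp add: power2_eq_square)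
  ultimately show ?thesis
    using r(1) by simp
qed

section \<open>Consecutive decompositions and their sides\<close>

lemma tri_sq_bij:
  fixes y :: "nat \<Rightarrow> point"
  assumes "tri_sq (image_mset y (mset_set {..<n})) T S s"
  shows "inj_on y {..<n}" "y ` {..<n} = T \<union> S" "T \<inter> S = {}"
proof -
  from assms have eq: "image_mset y (mset_set {..<n}) = mset_set T + mset_set S"
    and fin: "finite T" "finite S"
    and d: "convex hull T \<inter> convex hull S = {}"
    using equilateral_triangle_card square_card unfolding tri_sq_def by blast+
  show TS: "T \<inter> S = {}"
    using d hull_subset[of T convex] hull_subset[of S convex] by blast
  have "set_mset (image_mset y (mset_set {..<n})) = T \<union> S"
    unfolding eq using fin by simp
  then show im: "y ` {..<n} = T \<union> S"
    by simp
  \<comment> \<open>No vertex is repeated, so there are as many robots as occupied points, and no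
    two robots coincide.\<close>
  have "size (image_mset y (mset_set {..<n})) = card (T \<union> S)"
    unfolding eq using fin TS by (simp add: card_Un_disjoint)
  then show "inj_on y {..<n}"
    using im by (intro eq_card_imp_inj_on) simp_all
qed

text \<open>The side is the least distance between distinct vertices.\<close>

lemma square_side_unique:
  assumes "square S s" "square S s'"
  shows "s = s'"
proof -
  have *: "s \<le> s'" if sq: "square S s" "square S s'" for s s' :: real
  proof -
    obtain a u v where "S = {a, a + u, a + u + v, a + v}" "norm u = s'" "s' > 0"
      using sq(2) unfolding square_def by blast
    then have "a + u \<in> S" "a \<in> S" "a + u \<noteq> a" "dist (a + u) a = s'"
      by (auto simp: dist_norm)
    then show ?thesis
      using square_dist_ge[OF sq(1)] by metis
  qed
  show ?thesis
    using *[OF assms] *[OF assms(2,1)] by simp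
qed

lemma two_in_or_rest:
  assumes "A \<subseteq> B \<union> C"
  obtains p q where "p \<in> A" "q \<in> A" "p \<in> B" "q \<in> B" "p \<noteq> q"
  | a where "A - {a} \<subseteq> C"
  using assms by blast

text \<open>The vertices of \<open>S\<close> stay in place and are shared out between
  \<open>T'\<close> and \<open>S'\<close>. Two of them in \<open>T'\<close> make \<open>s'\<close> a
  distance between vertices of \<open>S\<close>, hence at least \<open>s\<close>. Otherwise three
  lie in \<open>S'\<close>, and three vertices determine a square.\<close>

lemma side_mono_triangle_moves:
  fixes y y' :: "nat \<Rightarrow> point"
  assumes TS: "tri_sq (image_mset y (mset_set {..<n})) T S s"
    and TS': "tri_sq (image_mset y' (mset_set {..<n})) T' S' s'"
    and moves: "\<And>i. i < n \<Longrightarrow> y' i = y i \<or> y i \<in> T"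
  shows "s \<le> s'"
proof -
  note b = tri_sq_bij[OF TS] and b' = tri_sq_bij[OF TS']
  have sq: "square S s" "square S' s'" and eq: "equilateral_triangle T' s'"
    using TS TS' by (auto simp: tri_sq_def)
  have sub: "S \<subseteq> T' \<union> S'"
  proof
    fix p assume p: "p \<in> S"
    then obtain i where "i < n" "y i = p"
      using b(2) by (metis UnCI imageE lessThan_iff)
    with moves[of i] p b(3) have "y' i = p"
      by blast
    with \<open>i < n\<close> show "p \<in> T' \<union> S'"
      using b'(2) by blast
  qed
  from two_in_or_rest[OF sub] show ?thesis
  proof cases
    case (1 p q)
    then show ?thesis
      using square_dist_ge[OF sq(1)] equilateral_triangle_dist[OF eq] by metis
  next
    case (2 a)
    have "3 \<le> card (S - {a})"
      using square_card[OF sq(1)] by (simp add: card_Diff_singleton_if)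
    then obtain X where X: "X \<subseteq> S - {a}" "card X = 3"
      by (rule obtain_subset_with_card_n)
    from X(2) obtain p q r where "X = {p, q, r}" "p \<noteq> q" "q \<noteq> r" "p \<noteq> r"
      unfolding card_3_iff by blast
    moreover have "X \<subseteq> S \<inter> S'"
      using X 2 by blast
    ultimately have "S = S'"
      using square_three_points[OF sq, of p q r] by simp
    then show ?thesis
      using square_side_unique sq by blast
  qed
qed

text \<open>Suppose \<open>s' < s\<close>. The vertices of \<open>T\<close> stay in place; two in
  \<open>T'\<close> would give \<open>s = s'\<close>, and all three in \<open>S'\<close> is
  impossible, so exactly two lie in \<open>S'\<close>, where they span a diagonal. The other
  diagonal of \<open>S'\<close> then has length \<open>s\<close>, and the two remaining vertices of
  \<open>T'\<close> have distance s / sqrt 2. All four of these points come from vertices of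
  \<open>S\<close>, contradicting \<open>cross_no_split\<close>.\<close>

lemma side_mono_square_moves:
  fixes y y' :: "nat \<Rightarrow> point"
  assumes TS: "tri_sq (image_mset y (mset_set {..<n})) T S s"
    and TS': "tri_sq (image_mset y' (mset_set {..<n})) T' S' s'"
    and moves: "\<And>i. i < n \<Longrightarrow> y' i = y i \<or>
      y i \<in> S \<and> y' i = midpoint (y i) (center_of_gravity (mset_set S))"
  shows "s \<le> s'"
proof (rule ccontr)
  assume less: "\<not> s \<le> s'"
  note b = tri_sq_bij[OF TS] and b' = tri_sq_bij[OF TS']
  have sq: "square S s" "square S' s'" and eq: "equilateral_triangle T s" "equilateral_triangle T' s'"
    using TS TS' by (auto simp: tri_sq_def)
  have s: "s > 0" "s' > 0"
    using sq by (auto simp: square_def)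
  have sub: "T \<subseteq> T' \<union> S'"
  proof
    fix p assume p: "p \<in> T"
    then obtain i where "i < n" "y i = p"
      using b(2) by (metis UnCI imageE lessThan_iff)
    with moves[of i] p b(3) have "y' i = p"
      by blast
    with \<open>i < n\<close> show "p \<in> T' \<union> S'"
      using b'(2) by blast
  qed
  from two_in_or_rest[OF sub] obtain z where z: "T - {z} \<subseteq> S'"
  proof cases
    case (1 p q)
    then have "s = s'"
      using equilateral_triangle_dist[OF eq(1)] equilateral_triangle_dist[OF eq(2)] by metis
    with less show ?thesis
      by simp
  qed blast
  have "\<not> T \<subseteq> S'"
    using square_not_equilateral[OF sq(2) eq(1)] .
  then have zT: "z \<in> T" "z \<in> T'" and TS'_int: "T \<inter> S' = T - {z}" and TT'_int: "T \<inter> T' = {z}"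
    using z sub b'(3) by blast+
  have c: "card (T - {z}) = 2" "card (S' - T) = 2" "card (T' - T) = 2"
    using equilateral_triangle_card[OF eq(1)] equilateral_triangle_card[OF eq(2)]
      square_card[OF sq(2)] zT TS'_int TT'_int
    by (simp_all add: card_Diff_subset_Int Int_commute)
  obtain a b where ab: "T - {z} = {a, b}" "a \<noteq> b"
    using c(1) by (auto simp: card_2_iff)
  obtain p q where pq: "S' - T = {p, q}" "p \<noteq> q"
    using c(2) by (auto simp: card_2_iff)
  obtain r w where rw: "T' - T = {r, w}" "r \<noteq> w"
    using c(3) by (auto simp: card_2_iff)
  have S': "S' = {a, b, p, q}"
    using ab(1) pq(1) TS'_int by blast
  have "a \<in> T" "b \<in> T"
    using ab by blast+
  then have dab: "dist a b = s"
    using equilateral_triangle_dist[OF eq(1)] ab(2) by blast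
  \<comment> \<open>Distinct vertices of \<open>S'\<close> at a distance larger than
    \<open>s'\<close> are opposite.\<close>
  have s2: "s\<^sup>2 = 2 * s'\<^sup>2"
    using square_dist2[OF sq(2), of a b] S' ab(2) dab less s by (auto simp: power2_eq_iff)
  have dpq: "(dist p q)\<^sup>2 = s\<^sup>2"
    using square_opposite_dist2[OF sq(2) S'] square_card[OF sq(2)] dab s2 by simp
  have "r \<in> T'" "w \<in> T'"
    using rw by blast+
  then have drw: "(dist r w)\<^sup>2 = s\<^sup>2 / 2"
    using equilateral_triangle_dist[OF eq(2)] rw(2) s2 by simp
  define o1 where "o1 = center_of_gravity (mset_set S)"
  obtain e f where ef: "S = {o1 + e, o1 - e, o1 + f, o1 - f}"
    "e \<bullet> e = s\<^sup>2 / 2" "f \<bullet> f = s\<^sup>2 / 2" "e \<bullet> f = 0"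
    using square_cross[OF sq(1)] unfolding o1_def by metis
  define D where "D = {e, - e, f, - f}"
  define L where "L = {1, 1/2 :: real}"
  \<comment> \<open>A robot now outside \<open>T\<close> started at a vertex \<open>o1 + d\<close>
    of \<open>S\<close>; the factor \<open>l\<close> is 1 if it stayed and 1/2 if it moved.\<close>
  have pos: "\<exists>i d l. i < n \<and> y' i = m \<and> y i = o1 + d \<and> d \<in> D \<and> l \<in> L \<and>
      m = o1 + l *\<^sub>R d" if m: "m \<in> {p, q, r, w}" for m
  proof -
    have "m \<in> T' \<union> S'" "m \<notin> T"
      using m pq(1) rw(1) by blast+
    then obtain i where i: "i < n" "y' i = m"
      unfolding b'(2)[symmetric] by blast
    have yS: "y i \<in> S"
      using moves[OF i(1)] i(2) i(1) b(2) \<open>m \<notin> T\<close> by (metis UnE image_eqI lessThan_iff)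
    then obtain d where d: "d \<in> D" "y i = o1 + d"
      unfolding ef(1) D_def by fastforce
    have "m = o1 + 1 *\<^sub>R d \<or> m = o1 + (1/2) *\<^sub>R d"
      using moves[OF i(1)] i(2) d(2) unfolding o1_def[symmetric]
      by (auto simp: midpoint_def vec_eq_iff field_simps)
    moreover have "1 \<in> L" "1/2 \<in> L"
      by (simp_all add: L_def)
    ultimately show ?thesis
      using i d by metis
  qed
  obtain i1 d1 l1 where 1: "y' i1 = p" "y i1 = o1 + d1" "d1 \<in> D"
      "l1 \<in> L" "p = o1 + l1 *\<^sub>R d1" "i1 < n"
    using pos[of p] by blast
  obtain i2 d2 l2 where 2: "y' i2 = q" "y i2 = o1 + d2" "d2 \<in> D"
      "l2 \<in> L" "q = o1 + l2 *\<^sub>R d2" "i2 < n"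
    using pos[of q] by blast
  obtain i3 d3 l3 where 3: "y' i3 = r" "y i3 = o1 + d3" "d3 \<in> D"
      "l3 \<in> L" "r = o1 + l3 *\<^sub>R d3" "i3 < n"
    using pos[of r] by blast
  obtain i4 d4 l4 where 4: "y' i4 = w" "y i4 = o1 + d4" "d4 \<in> D"
      "l4 \<in> L" "w = o1 + l4 *\<^sub>R d4" "i4 < n"
    using pos[of w] by blast
  \<comment> \<open>Distinct points hold distinct robots, which started at distinct vertices because
    \<open>y\<close> is injective.\<close>
  have "distinct [p, q, r, w]"
    using pq rw b'(3) by auto
  then have "distinct [i1, i2, i3, i4]"
    using 1(1) 2(1) 3(1) 4(1) by auto
  then have "distinct [d1, d2, d3, d4]"
    using 1(2,6) 2(2,6) 3(2,6) 4(2,6) inj_onD[OF b(1)] by auto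
  moreover have "{d1, d2, d3, d4} \<subseteq> {e, - e, f, - f}" "{l1, l2, l3, l4} \<subseteq> {1, 1/2}"
    using 1(3,4) 2(3,4) 3(3,4) 4(3,4) unfolding D_def[symmetric] L_def[symmetric] by simp_all
  ultimately have "(dist r w)\<^sup>2 \<noteq> s\<^sup>2 / 2"
    using cross_no_split[of "s\<^sup>2 / 2" e f d1 d2 d3 d4 l1 l2 l3 l4 o1] ef s dpq
    unfolding 1(5) 2(5) 3(5) 4(5) by simp
  with drw show False
    by simp
qed

section \<open>Widths and averages\<close>

text \<open>Both vectors have length \<open>s\<close> and lie within 30 degrees of the second axis,
  so the lines they span meet at less than 60 degrees. Numerically, the product \<open>b * d\<close>
  exceeds 3/4 of the squared length, while \<open>a * c\<close> is at most 1/4 of it.\<close>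

lemma inner_near_axis:
  fixes a b c d s :: real
  assumes "a\<^sup>2 + b\<^sup>2 = s\<^sup>2" "c\<^sup>2 + d\<^sup>2 = s\<^sup>2" "\<bar>a\<bar> < s / 2" "\<bar>c\<bar> < s / 2"
  shows "s\<^sup>2 / 2 < \<bar>a * c + b * d\<bar>"
proof -
  have s: "s > 0"
    using assms(3) by linarith
  have sq: "a\<^sup>2 < (s/2)\<^sup>2" "c\<^sup>2 < (s/2)\<^sup>2"
    using assms(3,4) by (metis abs_ge_zero power2_abs power_strict_mono zero_less_numeral)+
  have "3/4 * s\<^sup>2 < b\<^sup>2" "3/4 * s\<^sup>2 < d\<^sup>2"
    using sq assms(1,2) by (simp_all add: power_divide)
  then have "(3/4 * s\<^sup>2) * (3/4 * s\<^sup>2) < b\<^sup>2 * d\<^sup>2"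
    using s by (intro mult_strict_mono) auto
  then have "(3/4 * s\<^sup>2)\<^sup>2 < \<bar>b * d\<bar>\<^sup>2"
    by (simp add: power2_eq_square mult_ac)
  then have "3/4 * s\<^sup>2 < \<bar>b * d\<bar>"
    by (rule power_less_imp_less_base) simp
  moreover have "\<bar>a * c\<bar> \<le> (s/2) * (s/2)"
    unfolding abs_mult using assms(3,4) by (intro mult_mono) auto
  moreover have "(s/2) * (s/2) = s\<^sup>2 / 4"
    by (simp add: power2_eq_square)
  moreover have "\<bar>b * d\<bar> \<le> \<bar>a * c + b * d\<bar> + \<bar>a * c\<bar>"
    by linarith
  ultimately show ?thesis
    by linarith
qed

text \<open>The angle is between 60 and 120 degrees, which covers two sides of the triangle as well
  as two sides of the square; such vectors cannot both be nearly orthogonal to axis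
  \<open>k\<close>.\<close>

lemma planar_width:
  fixes u v :: point
  assumes "norm u = s" "norm v = s" "\<bar>u \<bullet> v\<bar> \<le> s\<^sup>2 / 2"
  shows "s / 2 \<le> \<bar>u $ k\<bar> \<or> s / 2 \<le> \<bar>v $ k\<bar>"
proof (rule ccontr)
  assume "\<not> ?thesis"
  then have *: "\<bar>u $ k\<bar> < s / 2" "\<bar>v $ k\<bar> < s / 2"
    by auto
  have n: "(u $ 1)\<^sup>2 + (u $ 2)\<^sup>2 = s\<^sup>2" "(v $ 1)\<^sup>2 + (v $ 2)\<^sup>2 = s\<^sup>2"
    using assms(1,2) power2_norm_eq_inner[of u] power2_norm_eq_inner[of v]
    by (simp_all add: inner_vec_def sum_2 power2_eq_square)
  have "s\<^sup>2 / 2 < \<bar>u \<bullet> v\<bar>"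
  proof (cases "k = 1")
    case True
    then show ?thesis
      using inner_near_axis[OF n] * by (simp add: inner_vec_def sum_2)
  next
    case False
    then have "k = 2"
      using exhaust_2 by blast
    then show ?thesis
      using inner_near_axis[of "u $ 2" "u $ 1" s "v $ 2" "v $ 1"] n *
      by (simp add: inner_vec_def sum_2 add.commute)
  qed
  with assms(3) show False
    by simp
qed

lemma equilateral_triangle_width:
  assumes "equilateral_triangle T s"
  obtains p q where "p \<in> T" "q \<in> T" "s / 2 \<le> p $ k - q $ k"
proof -
  obtain a b c where T: "T = {a, b, c}" and d: "dist a b = s" "dist b c = s" "dist c a = s"
    using assms unfolding equilateral_triangle_def by blast
  have "(b - a) \<bullet> (b - a) = s\<^sup>2" "(c - a) \<bullet> (c - a) = s\<^sup>2" "(b - c) \<bullet> (b - c) = s\<^sup>2"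
    using d by (simp_all add: dist_norm norm_minus_commute flip: power2_norm_eq_inner)
  moreover have "(b - c) \<bullet> (b - c) =
      (b - a) \<bullet> (b - a) + (c - a) \<bullet> (c - a) - 2 * ((b - a) \<bullet> (c - a))"
    by (simp add: inner_diff_left inner_diff_right inner_commute)
  ultimately have "(b - a) \<bullet> (c - a) = s\<^sup>2 / 2"
    by simp
  then have "\<bar>(b - a) \<bullet> (c - a)\<bar> \<le> s\<^sup>2 / 2"
    using zero_le_power2[of s] by linarith
  moreover have "norm (b - a) = s" "norm (c - a) = s"
    using d by (simp_all add: dist_norm norm_minus_commute)
  ultimately have "s / 2 \<le> \<bar>b $ k - a $ k\<bar> \<or> s / 2 \<le> \<bar>c $ k - a $ k\<bar>"
    using planar_width[of "b - a" s "c - a" k] by simp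
  then show thesis
    using that[of a b] that[of b a] that[of a c] that[of c a] T by (auto simp: abs_if split: if_splits)
qed

lemma square_width:
  assumes "square S s"
  obtains p q where "p \<in> S" "q \<in> S" "s / 2 \<le> p $ k - q $ k"
proof -
  obtain a u v where S: "S = {a, a + u, a + u + v, a + v}"
    and uv: "norm u = s" "norm v = s" "u \<bullet> v = 0"
    using assms unfolding square_def by blast
  have "s / 2 \<le> \<bar>u $ k\<bar> \<or> s / 2 \<le> \<bar>v $ k\<bar>"
    using planar_width[OF uv(1,2), of k] uv(3) by simp
  moreover have "a \<in> S" "a + u \<in> S" "a + v \<in> S"
    by (simp_all add: S)
  ultimately show thesis
    using that[of a "a + u"] that[of "a + u" a] that[of a "a + v"] that[of "a + v" a]
    by (auto simp: abs_if split: if_splits)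
qed

lemma square_dist_le:
  assumes "square S s" "p \<in> S" "q \<in> S"
  shows "dist p q \<le> 2 * s"
proof (cases "p = q")
  case False
  show ?thesis
  proof (rule power2_le_imp_le)
    show "(dist p q)\<^sup>2 \<le> (2 * s)\<^sup>2"
      using square_dist2[OF assms False] zero_le_power2[of s] by (auto simp: power_mult_distrib)
  qed (use assms(1) in \<open>simp add: square_def\<close>)
qed (use assms(1) in \<open>simp add: square_def\<close>)

lemma equilateral_triangle_dist_le:
  assumes "equilateral_triangle T s" "p \<in> T" "q \<in> T"
  shows "dist p q \<le> 2 * s"
  using assms equilateral_triangle_dist[OF assms]
  by (cases "p = q") (auto simp: equilateral_triangle_def)

section \<open>Averages with one entry away from the bound\<close>

lemma average_le:
  fixes h :: "'a \<Rightarrow> real"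
  assumes "finite I" "j \<in> I" "h j \<le> V" "\<And>i. i \<in> I \<Longrightarrow> h i \<le> U"
  shows "sum h I / card I \<le> U - (U - V) / card I"
proof -
  have "sum h (I - {j}) \<le> of_nat (card (I - {j})) * U"
    using assms(4) by (intro sum_bounded_above) auto
  moreover have c: "card I > 0"
    using assms by (auto simp: card_gt_0_iff)
  moreover have "sum h I = h j + sum h (I - {j})"
    using assms by (simp add: sum.remove)
  ultimately have "sum h I \<le> V + (real (card I) - 1) * U"
    using assms by (simp add: of_nat_diff)
  then show ?thesis
    using c by (simp add: field_simps)
qed

lemma average_ge:
  fixes h :: "'a \<Rightarrow> real"
  assumes "finite I" "j \<in> I" "V \<le> h j" "\<And>i. i \<in> I \<Longrightarrow> L \<le> h i"
  shows "L + (V - L) / card I \<le> sum h I / card I"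
  using average_le[of I j "\<lambda>i. - h i" "- V" "- L"] assms
  by (simp add: sum_negf diff_divide_distrib)

lemma center_of_gravity_mset_set:
  "center_of_gravity (mset_set X) $ k = (\<Sum>p\<in>X. p $ k) / card X"
proof -
  have "sum_mset (mset_set X) = (\<Sum>p\<in>X. p)"
    by (simp add: sum_unfold_sum_mset)
  then show ?thesis
    by (simp add: center_of_gravity_def divide_inverse_commute)
qed

lemma center_of_gravity_configuration:
  "center_of_gravity (configuration n x t) $ k = (\<Sum>i<n. x t i $ k) / card {..<n}"
proof -
  have "sum_mset (configuration n x t) = (\<Sum>i<n. x t i)"
    by (simp add: configuration_def sum_unfold_sum_mset)
  then show ?thesis
    by (simp add: center_of_gravity_def configuration_def divide_inverse_commute)
qed

section \<open>Convergence when only one figure makes halving moves\<close>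

text \<open>\<open>own\<close> selects the figure whose robots make halving moves, so that both
  singletons are treated at once. The geometric input proved differently for the two figures enters
  as \<open>side_mono\<close>.\<close>

locale half_moves =
  fixes n :: nat and x :: "nat \<Rightarrow> nat \<Rightarrow> point" and A :: "nat \<Rightarrow> nat set"
    and own :: "point set \<Rightarrow> point set \<Rightarrow> point set"
  assumes n: "n \<ge> 1"
    and fair: "fair_schedule n A"
    and own: "own T S = T \<or> own T S = S"
    and idle: "i < n \<Longrightarrow> i \<notin> A t \<Longrightarrow> x (Suc t) i = x t i"
    and active: "i < n \<Longrightarrow> i \<in> A t \<Longrightarrow> x (Suc t) i = center_of_gravity (configuration n x t) \<or>
      (\<exists>T S s. tri_sq (configuration n x t) T S s \<and> x t i \<in> own T S \<and>
        x (Suc t) i = midpoint (x t i) (center_of_gravity (mset_set (own T S))))"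
    and side_mono: "tri_sq (configuration n x t) T S s \<Longrightarrow>
      tri_sq (configuration n x (Suc t)) T' S' s' \<Longrightarrow>
      (\<And>i. i < n \<Longrightarrow> x (Suc t) i = x t i \<or> x t i \<in> own T S \<and>
        x (Suc t) i = midpoint (x t i) (center_of_gravity (mset_set (own T S)))) \<Longrightarrow>
      s \<le> s'"
begin

section \<open>The range of one coordinate over time\<close>

definition up :: "2 \<Rightarrow> nat \<Rightarrow> real" where
  "up k t = Max ((\<lambda>i. x t i $ k) ` {..<n})"

definition lo :: "2 \<Rightarrow> nat \<Rightarrow> real" where
  "lo k t = Min ((\<lambda>i. x t i $ k) ` {..<n})"

lemma le_up: "i < n \<Longrightarrow> x t i $ k \<le> up k t"
  by (simp add: up_def)

lemma lo_le: "i < n \<Longrightarrow> lo k t \<le> x t i $ k"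
  by (simp add: lo_def)

lemma up_attained: obtains i where "i < n" "x t i $ k = up k t"
proof -
  have "up k t \<in> (\<lambda>i. x t i $ k) ` {..<n}"
    unfolding up_def using n by (intro Max_in) (auto simp: lessThan_empty_iff)
  then show thesis
    using that by auto
qed

lemma lo_attained: obtains i where "i < n" "x t i $ k = lo k t"
proof -
  have "lo k t \<in> (\<lambda>i. x t i $ k) ` {..<n}"
    unfolding lo_def using n by (intro Min_in) (auto simp: lessThan_empty_iff)
  then show thesis
    using that by auto
qed

lemma lo_le_up: "lo k t \<le> up k t"
  using le_up[of 0 t k] lo_le[of 0 k t] n by simp

lemma center_le: "center_of_gravity (configuration n x t) $ k \<le> up k t - (up k t - lo k t) / n"
proof -
  obtain j where j: "j < n" "x t j $ k = lo k t"
    using lo_attained .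
  then show ?thesis
    using average_le[of "{..<n}" j "\<lambda>i. x t i $ k" "lo k t" "up k t"] le_up
    by (simp add: center_of_gravity_configuration)
qed

lemma center_ge: "lo k t + (up k t - lo k t) / n \<le> center_of_gravity (configuration n x t) $ k"
proof -
  obtain j where j: "j < n" "x t j $ k = up k t"
    using up_attained .
  then show ?thesis
    using average_ge[of "{..<n}" j "up k t" "\<lambda>i. x t i $ k" "lo k t"] lo_le
    by (simp add: center_of_gravity_configuration)
qed

lemma group_range:
  assumes "tri_sq (configuration n x t) T S s" "p \<in> T \<union> S"
  shows "p $ k \<le> up k t" "lo k t \<le> p $ k"
proof -
  obtain i where "i < n" "x t i = p"
    using tri_sq_bij(2)[OF assms(1)[unfolded configuration_def]] assms(2)
    by (metis imageE lessThan_iff)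
  then show "p $ k \<le> up k t" "lo k t \<le> p $ k"
    using le_up lo_le by metis+
qed

text \<open>The figure has extent at least \<open>s / 2\<close> along axis \<open>k\<close>, so some
  vertex is that far below the maximum. Averaging over at most four vertices leaves
  \<open>s / 8\<close>, and going halfway leaves \<open>s / 16\<close>.\<close>

lemma own_move_range:
  assumes TS: "tri_sq (configuration n x t) T S s" and p: "p \<in> own T S"
  shows "midpoint p (center_of_gravity (mset_set (own T S))) $ k \<le> up k t - s / 16"
    and "lo k t \<le> midpoint p (center_of_gravity (mset_set (own T S))) $ k"
proof -
  define X where "X = own T S"
  have sub: "X \<subseteq> T \<union> S"
    using own[of T S] by (auto simp: X_def)
  have eq: "equilateral_triangle T s" "square S s"
    using TS by (auto simp: tri_sq_def)
  have X: "finite X" "card X > 0" "card X \<le> 4" "s > 0"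
    using own[of T S] equilateral_triangle_card[OF eq(1)] square_card[OF eq(2)] eq
    by (auto simp: X_def square_def)
  obtain a b where ab: "a \<in> X" "b \<in> X" "s / 2 \<le> a $ k - b $ k"
    using own[of T S] equilateral_triangle_width[OF eq(1), of k] square_width[OF eq(2), of k]
    unfolding X_def by metis
  have U: "q $ k \<le> up k t" "lo k t \<le> q $ k" if "q \<in> X" for q
    using group_range[OF TS] that sub by auto
  let ?c = "center_of_gravity (mset_set X)"
  have "?c $ k \<le> up k t - (up k t - b $ k) / card X"
    using average_le[of X b "\<lambda>q. q $ k" "b $ k" "up k t"] X U ab
    by (simp add: center_of_gravity_mset_set)
  moreover have "s / 8 \<le> (up k t - b $ k) / card X"
    using frac_le[of "up k t - b $ k" "s / 2" "card X" 4] X U[OF ab(1)] ab(3) by simp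
  ultimately have c_le: "?c $ k \<le> up k t - s / 8"
    by linarith
  have "lo k t + (b $ k - lo k t) / card X \<le> ?c $ k"
    using average_ge[of X b "b $ k" "\<lambda>q. q $ k" "lo k t"] X U ab
    by (simp add: center_of_gravity_mset_set)
  moreover have "0 \<le> (b $ k - lo k t) / card X"
    using U[OF ab(2)] by simp
  ultimately have c_ge: "lo k t \<le> ?c $ k"
    by linarith
  have mid: "midpoint p ?c $ k = (p $ k + ?c $ k) / 2"
    by (simp add: midpoint_def)
  have p': "p $ k \<le> up k t" "lo k t \<le> p $ k"
    using U p by (simp_all add: X_def)
  show "midpoint p (center_of_gravity (mset_set (own T S))) $ k \<le> up k t - s / 16"
    using c_le p' unfolding X_def[symmetric] mid by simp
  show "lo k t \<le> midpoint p (center_of_gravity (mset_set (own T S))) $ k"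
    using c_ge p' unfolding X_def[symmetric] mid by simp
qed

lemma step_range:
  assumes "i < n"
  shows "x (Suc t) i $ k \<le> up k t" "lo k t \<le> x (Suc t) i $ k"
proof -
  have "0 \<le> (up k t - lo k t) / n"
    using lo_le_up by simp
  then have "center_of_gravity (configuration n x t) $ k \<le> up k t"
    "lo k t \<le> center_of_gravity (configuration n x t) $ k"
    using center_le[of t k] center_ge[of k t] by linarith+
  \<comment> \<open>Positivity of the side weakens the bound of \<open>own_move_range\<close> to
    \<open>up k t\<close>.\<close>
  moreover have "s > 0" if "tri_sq P T S s" for P T S s
    using that by (auto simp: tri_sq_def square_def)
  ultimately have "x (Suc t) i $ k \<le> up k t \<and> lo k t \<le> x (Suc t) i $ k"
    using active[OF assms] idle[OF assms] le_up[OF assms] lo_le[OF assms]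
      own_move_range[of t _ _ _ _ k] by (smt (verit) divide_pos_pos)
  then show "x (Suc t) i $ k \<le> up k t" "lo k t \<le> x (Suc t) i $ k"
    by auto
qed

lemma decseq_up: "decseq (up k)"
  using up_attained step_range(1) by (metis decseq_SucI)

lemma incseq_lo: "incseq (lo k)"
  using lo_attained step_range(2) by (metis incseq_SucI)

text \<open>By pigeonhole, two of robot \<open>i\<close>, a robot at the maximum and a robot at the
  minimum belong to the same figure. Their coordinates differ by at least \<open>c\<close>, and the
  figure has diameter at most \<open>2 * s\<close>.\<close>

lemma side_ge_depth:
  assumes TS: "tri_sq (configuration n x t) T S s" and i: "i < n"
    and c: "x t i $ k + c \<le> up k t" "lo k t + c \<le> x t i $ k" "c \<le> up k t - lo k t"
  shows "c \<le> 2 * s"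
proof -
  obtain a b where ab: "a < n" "x t a $ k = up k t" "b < n" "x t b $ k = lo k t"
    using up_attained lo_attained by metis
  have near: "p $ k - q $ k \<le> 2 * s" if "p \<in> T \<and> q \<in> T \<or> p \<in> S \<and> q \<in> S" for p q
  proof -
    have "dist p q \<le> 2 * s"
      using that equilateral_triangle_dist_le square_dist_le TS unfolding tri_sq_def by metis
    moreover have "p $ k - q $ k \<le> dist p q"
      using dist_vec_nth_le[of p k q] by (simp add: dist_real_def)
    ultimately show ?thesis
      by linarith
  qed
  have "x t j \<in> T \<union> S" if "j < n" for j
    using tri_sq_bij(2)[OF TS[unfolded configuration_def]] that by blast
  from this[OF i] this[OF ab(1)] this[OF ab(3)]
  consider "x t i \<in> T \<and> x t a \<in> T \<or> x t i \<in> S \<and> x t a \<in> S"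
    | "x t i \<in> T \<and> x t b \<in> T \<or> x t i \<in> S \<and> x t b \<in> S"
    | "x t a \<in> T \<and> x t b \<in> T \<or> x t a \<in> S \<and> x t b \<in> S"
    by blast
  then show ?thesis
  proof cases
    case 1
    then show ?thesis
      using near[of "x t a" "x t i"] ab c by auto
  next
    case 2
    then show ?thesis
      using near[of "x t i" "x t b"] ab c by auto
  next
    case 3
    then show ?thesis
      using near[of "x t a" "x t b"] ab c by auto
  qed
qed

lemma limits_eq:
  assumes M: "up k \<longlonglongrightarrow> M" and m: "lo k \<longlonglongrightarrow> m"
  shows "M \<le> m"
proof (rule ccontr)
  assume "\<not> M \<le> m"
  then have W: "M - m > 0"
    by simp
  have up_M: "M \<le> up k t" and lo_m: "lo k t \<le> m" for t
    using decseq_ge[OF decseq_up M] incseq_le[OF incseq_lo m] by blast+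
  \<comment> \<open>Half of the depth \<open>(M - m) / n\<close> that averaging guarantees; the
    other half absorbs the amount by which the current range still exceeds
    \<open>[m, M]\<close>.\<close>
  define c where "c = (M - m) / (2 * n)"
  have c: "c > 0" "(M - m) / n = 2 * c"
    using W n by (simp_all add: c_def field_simps)
  have "(M - m) / (2 * n) \<le> (M - m) / 1"
    using W n by (intro divide_left_mono) auto
  then have c_le: "c \<le> M - m"
    by (simp add: c_def)
  have "eventually (\<lambda>t. up k t < M + c) sequentially" "eventually (\<lambda>t. lo k t > m - c) sequentially"
    using order_tendstoD(2)[OF M] order_tendstoD(1)[OF m] c(1) by simp_all
  then obtain t0 where t0: "\<And>t. t \<ge> t0 \<Longrightarrow> up k t \<le> M + c \<and> m - c \<le> lo k t"
    unfolding eventually_sequentially by (metis le_trans less_imp_le nle_le)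
  let ?g = "\<lambda>t. center_of_gravity (configuration n x t)"
  have center: "?g t $ k \<le> M - c" "m + c \<le> ?g t $ k" if "t \<ge> t0" for t
  proof -
    have "(M - m) / n \<le> (up k t - lo k t) / n"
      using up_M[of t] lo_m[of t] by (intro divide_right_mono) auto
    then show "?g t $ k \<le> M - c" "m + c \<le> ?g t $ k"
      using center_le[of t k] center_ge[of k t] t0[OF that] c(2) by linarith+
  qed
  \<comment> \<open>The side at time \<open>t0\<close>, if there is a decomposition then, capped at
    the bound \<open>c / 2\<close> supplied by \<open>side_ge_depth\<close>.\<close>
  obtain \<sigma> where \<sigma>: "\<sigma> > 0" "\<sigma> \<le> c / 2" "\<And>T S s. tri_sq (configuration n x t0) T S s \<Longrightarrow> \<sigma> \<le> s"
  proof (cases "\<exists>T S s. tri_sq (configuration n x t0) T S s")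
    case True
    then obtain T S s where TS: "tri_sq (configuration n x t0) T S s"
      by blast
    then have "s > 0"
      by (auto simp: tri_sq_def square_def)
    with that[of "min s (c / 2)"] c(1) tri_sq_unique(3)[OF TS] show thesis
      by fastforce
  next
    case False
    with that[of "c / 2"] c(1) show thesis
      by simp
  qed
  have side: "\<sigma> \<le> s" if "t \<ge> t0" "tri_sq (configuration n x t) T S s" for t T S s
    using that
  proof (induction t arbitrary: T S s rule: nat_induct_at_least)
    case base
    then show ?case
      using \<sigma>(3) by blast
  next
    case (Suc t)
    show ?case
    \<comment> \<open>Only the position matters: a robot at the old center of gravity has depth
      \<open>c\<close>, whether or not it has just moved there.\<close>
    proof (cases "\<exists>i<n. x (Suc t) i = ?g t")
      case True
      then obtain i where i: "i < n" "x (Suc t) i = ?g t"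
        by blast
      have "c \<le> 2 * s"
      proof (rule side_ge_depth[OF Suc.prems i(1)])
        show "x (Suc t) i $ k + c \<le> up k (Suc t)" "lo k (Suc t) + c \<le> x (Suc t) i $ k"
          using center[OF Suc.hyps] up_M[of "Suc t"] lo_m[of "Suc t"] i(2) by simp_all
        show "c \<le> up k (Suc t) - lo k (Suc t)"
          using up_M[of "Suc t"] lo_m[of "Suc t"] c_le by simp
      qed
      then show ?thesis
        using \<sigma>(2) by simp
    next
      case no_center: False
      show ?thesis
      proof (cases "\<forall>i<n. x (Suc t) i = x t i")
        case True
        then have "configuration n x (Suc t) = configuration n x t"
          unfolding configuration_def by (intro image_mset_cong) simp
        then show ?thesis
          using Suc by simp
      next
        case False
        \<comment> \<open>A robot that changed place without reaching the center made an own-figure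
          move, so a decomposition existed at time \<open>t\<close>.\<close>
        then obtain i T0 S0 s0 where TS0: "tri_sq (configuration n x t) T0 S0 s0"
          using active idle no_center by metis
        have "s0 \<le> s"
        proof (rule side_mono[OF TS0 Suc.prems])
          fix j assume "j < n"
          then show "x (Suc t) j = x t j \<or> x t j \<in> own T0 S0 \<and>
              x (Suc t) j = midpoint (x t j) (center_of_gravity (mset_set (own T0 S0)))"
            \<comment> \<open>Uniqueness makes the moves of all robots refer to the same
              \<open>T0\<close> and \<open>S0\<close>.\<close>
            using active[of j t] idle[of j t] no_center tri_sq_unique(1,2)[OF TS0] by metis
        qed
        then show ?thesis
          using Suc.IH[OF TS0] by simp
      qed
    qed
  qed
  \<comment> \<open>An own-figure move ends \<open>\<sigma> / 16\<close> below the current maximum,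
    which from \<open>t1\<close> on exceeds \<open>M\<close> by less than
    \<open>\<sigma> / 32\<close>.\<close>
  define d where "d = min c (\<sigma> / 32)"
  have d: "d > 0" "d \<le> c" "d \<le> \<sigma> / 32"
    using c \<sigma> by (auto simp: d_def)
  have "eventually (\<lambda>t. up k t < M + \<sigma> / 32) sequentially"
    using order_tendstoD(2)[OF M] \<sigma>(1) by simp
  then obtain t1' where "\<And>t. t \<ge> t1' \<Longrightarrow> up k t < M + \<sigma> / 32"
    unfolding eventually_sequentially by blast
  then obtain t1 where t1: "t1 \<ge> t0" "\<And>t. t \<ge> t1 \<Longrightarrow> up k t < M + \<sigma> / 32"
    by (metis max.bounded_iff nle_le)
  have moved: "x (Suc t) i $ k \<le> M - d" if "t \<ge> t1" "i < n" "i \<in> A t" for t i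
    using active[OF that(2,3)]
  proof (elim disjE exE conjE)
    assume "x (Suc t) i = ?g t"
    then show ?thesis
      using center(1)[of t] that(1) t1(1) d(2) by simp
  next
    fix T S s
    assume TS: "tri_sq (configuration n x t) T S s" "x t i \<in> own T S"
      and eq: "x (Suc t) i = midpoint (x t i) (center_of_gravity (mset_set (own T S)))"
    have "\<sigma> \<le> s"
      using side[OF _ TS(1)] that(1) t1(1) by simp
    then show ?thesis
      using own_move_range(1)[OF TS, of k] t1(2)[OF that(1)] d(3) unfolding eq[symmetric] by simp
  qed
  have "eventually (\<lambda>t. x t i $ k \<le> M - d) sequentially" if i: "i < n" for i
  proof -
    have "infinite {t. i \<in> A t}"
      using fair i unfolding fair_schedule_def by blast
    then obtain t2 where t2: "t2 \<ge> t1" "i \<in> A t2"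
      unfolding infinite_nat_iff_unbounded_le by auto
    \<comment> \<open>Once below \<open>M - d\<close>, a robot remains there: idle steps keep its
      place and active ones end below again.\<close>
    have "x t i $ k \<le> M - d" if "t \<ge> Suc t2" for t
      using that
    proof (induction t rule: nat_induct_at_least)
      case base
      then show ?case
        using moved[OF t2(1) i t2(2)] .
    next
      case (Suc t)
      then show ?case
        using moved[of t i] idle[OF i, of t] i t2(1) by (cases "i \<in> A t") auto
    qed
    then show ?thesis
      unfolding eventually_sequentially by blast
  qed
  \<comment> \<open>There are finitely many robots, so at some time all of them are below
    \<open>M - d\<close>, including the one that attains the maximum.\<close>
  then have "eventually (\<lambda>t. \<forall>i\<in>{..<n}. x t i $ k \<le> M - d) sequentially"
    by (intro eventually_ball_finite) auto
  then obtain t where t: "\<forall>i\<in>{..<n}. x t i $ k \<le> M - d"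
    unfolding eventually_sequentially by blast
  obtain i where "i < n" "x t i $ k = up k t"
    using up_attained .
  with t have "up k t \<le> M - d"
    by (metis lessThan_iff)
  with up_M[of t] d(1) show False
    by simp
qed

lemma coordinate_convergence: "\<exists>p. \<forall>i<n. (\<lambda>t. x t i $ k) \<longlonglongrightarrow> p"
proof -
  have "lo k 0 \<le> up k t" "lo k t \<le> up k 0" for t
    using lo_le_up[of k t] incseqD[OF incseq_lo, of 0 t k] decseqD[OF decseq_up, of 0 t k] by simp_all
  then obtain M m where M: "up k \<longlonglongrightarrow> M" and m: "lo k \<longlonglongrightarrow> m"
    using decseq_convergent[OF decseq_up] incseq_convergent[OF incseq_lo] by metis
  have "m \<le> M"
    using LIMSEQ_le[OF m M] lo_le_up by blast
  then have "M = m"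
    using limits_eq[OF M m] by simp
  then have "(\<lambda>t. x t i $ k) \<longlonglongrightarrow> M" if "i < n" for i
    using tendsto_sandwich[of "lo k" "\<lambda>t. x t i $ k" sequentially "up k" M] m M le_up lo_le that
    by simp
  then show ?thesis
    by blast
qed

lemma convergence: "convergence n x"
proof -
  obtain p where "\<And>k i. i < n \<Longrightarrow> (\<lambda>t. x t i $ k) \<longlonglongrightarrow> p k"
    using coordinate_convergence by metis
  then have "(\<lambda>t. x t i) \<longlonglongrightarrow> (\<chi> k. p k)" if "i < n" for i
    using that by (intro vec_tendstoI) simp
  then show ?thesis
    unfolding convergence_def by blast
qed

end

section \<open>Compatibility of the two singletons\<close>

lemma execution_step:
  assumes "execution n \<phi> Z A x" "i < n"
  shows "i \<notin> A t \<Longrightarrow> x (Suc t) i = x t i"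
    and "i \<in> A t \<Longrightarrow> Some (x (Suc t) i) = map_option (to_global (Z i) (x t i))
      (\<phi> i (image_mset (inv (to_global (Z i) (x t i))) (configuration n x t)))"
  using assms unfolding execution_def Let_def by (metis (full_types))+

lemma position_in_configuration: "i < n \<Longrightarrow> x t i \<in># configuration n x t"
  by (simp add: configuration_def)

lemma compatible_phi_T: "compatible {phi_T} convergence"
  unfolding compatible_def
proof (intro allI impI)
  fix n \<phi> Z A x
  assume n: "n \<ge> 1" and \<phi>: "\<forall>i<n. \<phi> i \<in> {phi_T}" and Z: "\<forall>i<n. local_frame (Z i)"
    and fair: "fair_schedule n A" and ex: "execution n \<phi> Z A x"
  interpret half_moves n x A "\<lambda>T S. T"
  proof
    fix t i assume i: "i < n" "i \<in> A t"
    have "Some (x (Suc t) i) = map_option (to_global (Z i) (x t i))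
        (phi_T (image_mset (inv (to_global (Z i) (x t i))) (configuration n x t)))"
      using execution_step(2)[OF ex i] \<phi> i(1) by simp
    then show "x (Suc t) i = center_of_gravity (configuration n x t) \<or>
      (\<exists>T S s. tri_sq (configuration n x t) T S s \<and> x t i \<in> T \<and>
        x (Suc t) i = midpoint (x t i) (center_of_gravity (mset_set T)))"
      using phi_T_cases[OF Z[rule_format, OF i(1)] position_in_configuration[OF i(1)]] by metis
  next
    fix t T S s T' S' s'
    assume TS: "tri_sq (configuration n x t) T S s" "tri_sq (configuration n x (Suc t)) T' S' s'"
      and moves: "\<And>i. i < n \<Longrightarrow> x (Suc t) i = x t i \<or> x t i \<in> T \<and>
        x (Suc t) i = midpoint (x t i) (center_of_gravity (mset_set T))"
    show "s \<le> s'"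
      using moves by (intro side_mono_triangle_moves[OF TS[unfolded configuration_def]]) blast
  qed (use n fair execution_step(1)[OF ex] in auto)
  show "convergence n x"
    by (rule convergence)
qed

lemma compatible_phi_S: "compatible {phi_S} convergence"
  unfolding compatible_def
proof (intro allI impI)
  fix n \<phi> Z A x
  assume n: "n \<ge> 1" and \<phi>: "\<forall>i<n. \<phi> i \<in> {phi_S}" and Z: "\<forall>i<n. local_frame (Z i)"
    and fair: "fair_schedule n A" and ex: "execution n \<phi> Z A x"
  interpret half_moves n x A "\<lambda>T S. S"
  proof
    fix t i assume i: "i < n" "i \<in> A t"
    have "Some (x (Suc t) i) = map_option (to_global (Z i) (x t i))
        (phi_S (image_mset (inv (to_global (Z i) (x t i))) (configuration n x t)))"
      using execution_step(2)[OF ex i] \<phi> i(1) by simp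
    then show "x (Suc t) i = center_of_gravity (configuration n x t) \<or>
      (\<exists>T S s. tri_sq (configuration n x t) T S s \<and> x t i \<in> S \<and>
        x (Suc t) i = midpoint (x t i) (center_of_gravity (mset_set S)))"
      using phi_S_cases[OF Z[rule_format, OF i(1)] position_in_configuration[OF i(1)]] by metis
  next
    fix t T S s T' S' s'
    assume TS: "tri_sq (configuration n x t) T S s" "tri_sq (configuration n x (Suc t)) T' S' s'"
      and moves: "\<And>i. i < n \<Longrightarrow> x (Suc t) i = x t i \<or> x t i \<in> S \<and>
        x (Suc t) i = midpoint (x t i) (center_of_gravity (mset_set S))"
    show "s \<le> s'"
      using moves by (rule side_mono_square_moves[OF TS[unfolded configuration_def]])
  qed (use n fair execution_step(1)[OF ex] in auto)
  show "convergence n x"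
    by (rule convergence)
qed

section \<open>The divergent execution\<close>

definition home :: "nat \<Rightarrow> point" where
  "home i = (if i < 3 then 0 else vector [10, 0])"

text \<open>An equilateral triangle of circumradius 2 followed by an axis-parallel square in cyclic
  order. Both have centroid 0 and side \<open>2 * sqrt 3\<close>.\<close>

definition offset :: "nat \<Rightarrow> point" where
  "offset i = [vector [2, 0], vector [- 1, sqrt 3], vector [- 1, - sqrt 3],
     vector [- sqrt 3, - sqrt 3], vector [sqrt 3, - sqrt 3],
     vector [sqrt 3, sqrt 3], vector [- sqrt 3, sqrt 3]] ! i"

definition shrinking :: "nat \<Rightarrow> nat \<Rightarrow> point" where
  "shrinking t i = home i + (1 / 2) ^ t *\<^sub>R offset i"

lemma offset_simps:
  "offset 0 = vector [2, 0]" "offset (Suc 0) = vector [- 1, sqrt 3]" "offset 2 = vector [- 1, - sqrt 3]"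
  "offset 3 = vector [- sqrt 3, - sqrt 3]" "offset 4 = vector [sqrt 3, - sqrt 3]"
  "offset 5 = vector [sqrt 3, sqrt 3]" "offset 6 = vector [- sqrt 3, sqrt 3]"
  by (simp_all add: offset_def numeral_eq_Suc)

lemma less_3: "{..<3} = {0, Suc 0, 2 :: nat}" and from_3: "{3..<7} = {3, 4, 5, 6 :: nat}"
  by auto

lemma norm_eq_2: "norm (p :: point) = sqrt ((p $ 1)\<^sup>2 + (p $ 2)\<^sup>2)"
  by (simp add: norm_vec_def L2_set_def sum_2)

abbreviation scale :: "nat \<Rightarrow> real" where
  "scale t \<equiv> (1 / 2) ^ t"

lemma shrinking_triangle:
  "equilateral_triangle (shrinking t ` {..<3}) (2 * sqrt 3 * scale t)"
proof -
  have d: "dist (shrinking t i) (shrinking t j) = scale t * norm (offset i - offset j)"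
    if "i < 3" "j < 3" for i j
    using that by (simp add: shrinking_def home_def dist_norm flip: scaleR_diff_right)
  have "norm (offset 0 - offset (Suc 0)) = 2 * sqrt 3" "norm (offset (Suc 0) - offset 2) = 2 * sqrt 3"
    "norm (offset 2 - offset 0) = 2 * sqrt 3"
    by (simp_all add: offset_simps norm_eq_2 real_sqrt_unique power_mult_distrib)
  then show ?thesis
    unfolding equilateral_triangle_def less_3
    by (intro conjI exI[of _ "shrinking t 0"] exI[of _ "shrinking t (Suc 0)"] exI[of _ "shrinking t 2"])
      (simp_all add: d)
qed

lemma shrinking_square:
  "square (shrinking t ` {3..<7}) (2 * sqrt 3 * scale t)"
proof -
  let ?u = "scale t *\<^sub>R vector [2 * sqrt 3, 0] :: point"
  let ?v = "scale t *\<^sub>R vector [0, 2 * sqrt 3] :: point"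
  have "shrinking t 4 = shrinking t 3 + ?u" "shrinking t 5 = shrinking t 3 + ?u + ?v"
    "shrinking t 6 = shrinking t 3 + ?v"
    by (simp_all add: shrinking_def home_def offset_simps vec_eq_iff forall_2 algebra_simps)
  then show ?thesis
    unfolding square_def from_3
    by (intro conjI exI[of _ "shrinking t 3"] exI[of _ ?u] exI[of _ ?v])
      (simp_all add: norm_eq_2 inner_vec_def sum_2)
qed

lemma shrinking_tri_sq:
  "tri_sq (configuration 7 shrinking t) (shrinking t ` {..<3}) (shrinking t ` {3..<7})
    (2 * sqrt 3 * scale t)"
proof -
  have "inj_on (shrinking t) {..<3}" "inj_on (shrinking t) {3..<7}"
    using equilateral_triangle_card(2)[OF shrinking_triangle] square_card(2)[OF shrinking_square]
    by (intro eq_card_imp_inj_on; simp)+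
  moreover have "mset_set {..<7} = mset_set {..<3} + mset_set {3..<7 :: nat}"
    by (subst mset_set_Union [symmetric]) (auto intro: arg_cong[where f = mset_set])
  ultimately have "configuration 7 shrinking t =
      mset_set (shrinking t ` {..<3}) + mset_set (shrinking t ` {3..<7})"
    by (simp add: configuration_def image_mset_mset_set)
  moreover have "convex hull (shrinking t ` {..<3}) \<inter> convex hull (shrinking t ` {3..<7}) = {}"
  proof -
    have r: "0 \<le> scale t" "scale t \<le> 1"
      by (simp_all add: power_le_one)
    then have r': "- scale t \<le> 5"
      by linarith
    have "sqrt 3 \<le> 2"
      by (rule real_le_lsqrt) simp_all
    then have s: "scale t * sqrt 3 \<le> 2"
      using r mult_mono[of "scale t" 1 "sqrt 3" 2] by simp
    \<comment> \<open>Vertical lines separate the figures: the triangle has first coordinates at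
      most 2, and the square at least 8.\<close>
    have c: "convex {p :: point. p $ 1 \<le> 5}" "convex {p :: point. p $ 1 \<ge> 6}"
      using convex_halfspace_le[of "axis 1 1 :: point" 5] convex_halfspace_ge[of 6 "axis 1 1 :: point"]
      by (simp_all add: inner_axis')
    have "shrinking t ` {..<3} \<subseteq> {p. p $ 1 \<le> 5}"
      using r r' by (auto simp: less_3 shrinking_def home_def offset_simps)
    then have "convex hull (shrinking t ` {..<3}) \<subseteq> {p. p $ 1 \<le> 5}"
      using c(1) by (rule hull_minimal)
    moreover have "shrinking t ` {3..<7} \<subseteq> {p. p $ 1 \<ge> 6}"
      using s r by (auto simp: from_3 shrinking_def home_def offset_simps)
    then have "convex hull (shrinking t ` {3..<7}) \<subseteq> {p. p $ 1 \<ge> 6}"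
      using c(2) by (rule hull_minimal)
    ultimately show ?thesis
      by force
  qed
  ultimately show ?thesis
    using shrinking_triangle shrinking_square by (simp add: tri_sq_def)
qed

text \<open>The offsets of each figure sum to zero, and its robots share one home.\<close>

lemma shrinking_center:
  assumes "I = {..<3} \<or> I = {3..<7}" "i \<in> I"
  shows "center_of_gravity (mset_set (shrinking t ` I)) = home i"
proof -
  have c: "card (shrinking t ` I) = card I" "card I \<noteq> 0"
    using assms(1) equilateral_triangle_card(2)[OF shrinking_triangle]
      square_card(2)[OF shrinking_square] by auto
  then have inj: "inj_on (shrinking t) I"
    using assms(1) by (intro eq_card_imp_inj_on) auto
  have "(\<Sum>j\<in>I. offset j) = 0"
    using assms(1) by (auto simp: less_3 from_3 offset_simps vec_eq_iff forall_2)
  moreover have "home j = home i" if "j \<in> I" for j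
    using that assms by (auto simp: home_def)
  then have "(\<Sum>j\<in>I. home j) = real (card I) *\<^sub>R home i"
    by (simp only: sum_constant_scaleR cong: sum.cong)
  ultimately have "(\<Sum>j\<in>I. shrinking t j) = real (card I) *\<^sub>R home i"
    by (simp add: shrinking_def sum.distrib flip: scaleR_sum_right)
  moreover have "sum_mset (mset_set (shrinking t ` I)) = (\<Sum>j\<in>I. shrinking t j)"
    using sum.reindex[OF inj, of "\<lambda>p. p"] by (simp add: sum_unfold_sum_mset)
  ultimately show ?thesis
    using c by (simp add: center_of_gravity_def)
qed

lemma shrinking_step: "shrinking (Suc t) i = midpoint (shrinking t i) (home i)"
  by (simp add: shrinking_def midpoint_def vec_eq_iff field_simps)

lemma shrinking_limit: "(\<lambda>t. shrinking t i) \<longlonglongrightarrow> home i"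
proof -
  have "(\<lambda>t. home i + scale t *\<^sub>R offset i) \<longlonglongrightarrow> home i + 0 *\<^sub>R offset i"
    by (intro tendsto_intros LIMSEQ_power_zero) simp
  then show ?thesis
    by (simp add: shrinking_def)
qed

lemma not_compatible_union: "\<not> compatible ({phi_T} \<union> {phi_S}) convergence"
proof
  define \<phi> where "\<phi> i = (if i < 3 then phi_T else phi_S)" for i :: nat
  define Z where "Z i = (1 :: real, mat 1 :: real^2^2)" for i :: nat
  define A where "A t = {..<7 :: nat}" for t :: nat
  assume comp: "compatible ({phi_T} \<union> {phi_S}) convergence"
  have Z: "local_frame (Z i)" for i
    by (simp add: Z_def local_frame_def rotation_matrix_def orthogonal_matrix_def)
  have "execution 7 \<phi> Z A shrinking"
    unfolding execution_def
  proof (intro allI impI)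
    fix t i :: nat assume i: "i < 7"
    note move = Z position_in_configuration[OF i] shrinking_tri_sq
    have "map_option (to_global (Z i) (shrinking t i)) (\<phi> i (image_mset
        (inv (to_global (Z i) (shrinking t i))) (configuration 7 shrinking t))) =
      Some (midpoint (shrinking t i) (home i))"
    proof (cases "i < 3")
      case True
      then show ?thesis
        using phi_T_move[OF move] shrinking_center[of "{..<3}" i] by (simp add: \<phi>_def)
    next
      case False
      then show ?thesis
        using phi_S_move[OF move] shrinking_center[of "{3..<7}" i] i by (simp add: \<phi>_def)
    qed
    then show "if i \<in> A t then (let \<gamma> = to_global (Z i) (shrinking t i) in Some (shrinking (Suc t) i) =
        map_option \<gamma> (\<phi> i (image_mset (inv \<gamma>) (configuration 7 shrinking t))))
      else shrinking (Suc t) i = shrinking t i"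
      using i by (simp only: A_def Let_def shrinking_step lessThan_iff if_True)
  qed
  moreover have "fair_schedule 7 A"
    by (simp add: fair_schedule_def A_def)
  moreover have "\<forall>i<7. \<phi> i \<in> {phi_T} \<union> {phi_S}"
    by (simp add: \<phi>_def)
  ultimately have "convergence 7 shrinking"
    using comp Z unfolding compatible_def by (meson one_le_numeral)
  \<comment> \<open>Robot 0 is a triangle robot and robot 3 a square robot.\<close>
  then obtain p where "(\<lambda>t. shrinking t 0) \<longlonglongrightarrow> p" "(\<lambda>t. shrinking t 3) \<longlonglongrightarrow> p"
    unfolding convergence_def by fastforce
  then have "home 0 = home 3"
    using shrinking_limit LIMSEQ_unique by metis
  then show False
    by (simp add: home_def vec_eq_iff forall_2)
qed

theorem theorem3:
  "compatible {phi_T} convergence \<and> compatible {phi_S} convergence \<and>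
   \<not> compatible ({phi_T} \<union> {phi_S}) convergence"
  using compatible_phi_T compatible_phi_S not_compatible_union by blast

end
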